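(* Let $\mathbb P$ be a probability measure on $\Omega_+$ under which $(\omega(x))_{x\ge0}$ is stationary and ergodic. Then \[E_0[D^x_\infty]=\min\{1,\mathbb E[\delta^0]\}\quad\text{for all } x\ge0.\] Moreover, if $\mathbb P[\omega(0)=(1,1/2,1/2,1/2,\dots)]<1$, then the walk is recurrent if and only if $\mathbb E[\delta^0]\le1$.
   Context: Cookie environments: $\Omega_+=([1/2,1]^{\mathbb N})^{\mathbb Z}$, $\omega(x)=(\omega(x,i))_{i\ge1}$. $P_{x,\omega}$ is the law of the nearest-neighbor process $(X_n)_{n\ge0}$ with $X_0=x$ which, on its $i$-th visit to site $z$, jumps to $z+1$ with probability $\omega(z,i)$ and to $z-1$ otherwise. Annealed measure $P_x[\cdot]=\mathbb E[P_{x,\omega}[\cdot]]$, expectation $E_x$. $\delta^x(\omega)=\sum_{i\ge1}(2\omega(x,i)-1)$. $D_n^x=\sum_{i=1}^{\#\{m<n:X_m=x\}}(2\omega(x,i)-1)$, $D^x_\infty=\lim_n D^x_n$. $R_k=\{X_n=k\text{ i.o.}\}$; a site $y$ is $\omega$-recurrent if $P_{x,\omega}[R_y]=1$ for all $x$ and $\omega$-transient if $P_{x,\omega}[R_y]=0$ for all $x$. Under the stationarity-ergodicity assumption, either every $x\ge0$ is $\mathbb P$-a.s. $\omega$-recurrent (the walk is called recurrent) or every $x\ge0$ is $\mathbb P$-a.s. $\omega$-transient (the walk is called transient). *)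

theory Defs
  imports "HOL-Probability.Probability"
begin

text \<open>Cookie environments. An environment is a function
  \<open>\<omega> :: int \<Rightarrow> nat \<Rightarrow> real\<close>; the cookie index is shifted by one:
  \<open>\<omega> x k\<close> (k = 0,1,2,...) is the paper's \<open>\<omega>(x,k+1)\<close>.\<close>

type_synonym env = "int \<Rightarrow> nat \<Rightarrow> real"

definition env_space :: "env measure" where
  "env_space = (\<Pi>\<^sub>M x\<in>(UNIV::int set). \<Pi>\<^sub>M i\<in>(UNIV::nat set). restrict_space borel {1/2..1::real})"

definition env_space_nonneg :: "(nat \<Rightarrow> nat \<Rightarrow> real) measure" where
  "env_space_nonneg = (\<Pi>\<^sub>M x\<in>(UNIV::nat set). \<Pi>\<^sub>M i\<in>(UNIV::nat set). restrict_space borel {1/2..1::real})"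

definition env_shift :: "(nat \<Rightarrow> nat \<Rightarrow> real) \<Rightarrow> (nat \<Rightarrow> nat \<Rightarrow> real)" where
  "env_shift f = (\<lambda>x. f (Suc x))"

definition nonneg_law :: "env measure \<Rightarrow> (nat \<Rightarrow> nat \<Rightarrow> real) measure" where
  "nonneg_law P = distr P env_space_nonneg (\<lambda>\<omega> x. \<omega> (int x))"

definition stationary_ergodic :: "env measure \<Rightarrow> bool" where
  "stationary_ergodic P \<longleftrightarrow>
     distr (nonneg_law P) env_space_nonneg env_shift = nonneg_law P \<and>
     (\<forall>A \<in> sets env_space_nonneg.
        env_shift -` A \<inter> space env_space_nonneg = A \<longrightarrow>
        measure (nonneg_law P) A = 0 \<or> measure (nonneg_law P) A = 1)"

text \<open>The walk, driven by an i.i.d. sequence of uniform variables \<open>u\<close>: on its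
  (k+1)-th visit to site z (k = number of earlier visits) it jumps to z+1 iff
  \<open>u n < \<omega> z k\<close>, which has probability \<open>\<omega> z k\<close>.\<close>
fun walk_prefix :: "env \<Rightarrow> int \<Rightarrow> (nat \<Rightarrow> real) \<Rightarrow> nat \<Rightarrow> int list" where
  "walk_prefix \<omega> x u 0 = [x]"
| "walk_prefix \<omega> x u (Suc n) =
     (let xs = walk_prefix \<omega> x u n; z = last xs;
          k = length (filter (\<lambda>y. y = z) (butlast xs))
      in xs @ [if u n < \<omega> z k then z + 1 else z - 1])"

definition walk :: "env \<Rightarrow> int \<Rightarrow> (nat \<Rightarrow> real) \<Rightarrow> nat \<Rightarrow> int" where
  "walk \<omega> x u n = last (walk_prefix \<omega> x u n)"

definition unif_seq :: "(nat \<Rightarrow> real) measure" where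
  "unif_seq = (\<Pi>\<^sub>M n\<in>(UNIV::nat set). uniform_measure lborel {0..1::real})"

definition path_space :: "(nat \<Rightarrow> int) measure" where
  "path_space = (\<Pi>\<^sub>M n\<in>(UNIV::nat set). count_space (UNIV::int set))"

definition quenched :: "env \<Rightarrow> int \<Rightarrow> (nat \<Rightarrow> int) measure" where
  "quenched \<omega> x = distr unif_seq path_space (walk \<omega> x)"

definition delta :: "env \<Rightarrow> int \<Rightarrow> ennreal" where
  "delta \<omega> x = (\<Sum>i. ennreal (2 * \<omega> x i - 1))"

definition drift_n :: "env \<Rightarrow> int \<Rightarrow> (nat \<Rightarrow> int) \<Rightarrow> nat \<Rightarrow> real" where
  "drift_n \<omega> x X n = (\<Sum>i < card {m. m < n \<and> X m = x}. 2 * \<omega> x i - 1)"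

text \<open>\<open>D^x_\<infinity> = lim_n D^x_n\<close>; the sequence is nondecreasing, so the limit is its supremum in [0,\<infinity>].\<close>
definition drift_inf :: "env \<Rightarrow> int \<Rightarrow> (nat \<Rightarrow> int) \<Rightarrow> ennreal" where
  "drift_inf \<omega> x X = (SUP n. ennreal (drift_n \<omega> x X n))"

definition R_event :: "int \<Rightarrow> (nat \<Rightarrow> int) set" where
  "R_event y = {X. infinite {n. X n = y}}"

definition omega_recurrent :: "env \<Rightarrow> int \<Rightarrow> bool" where
  "omega_recurrent \<omega> y \<longleftrightarrow> (\<forall>x. measure (quenched \<omega> x) (R_event y) = 1)"

definition omega_transient :: "env \<Rightarrow> int \<Rightarrow> bool" where
  "omega_transient \<omega> y \<longleftrightarrow> (\<forall>x. measure (quenched \<omega> x) (R_event y) = 0)"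

definition walk_recurrent :: "env measure \<Rightarrow> bool" where
  "walk_recurrent P \<longleftrightarrow> (\<forall>x::int. x \<ge> 0 \<longrightarrow> (AE \<omega> in P. omega_recurrent \<omega> x))"

definition annealed_E :: "env measure \<Rightarrow> int \<Rightarrow> (env \<Rightarrow> (nat \<Rightarrow> int) \<Rightarrow> ennreal) \<Rightarrow> ennreal" where
  "annealed_E P x F = (\<integral>\<^sup>+ \<omega>. (\<integral>\<^sup>+ X. F \<omega> X \<partial>(quenched \<omega> x)) \<partial>P)"

end

theory Submission
  imports Defs
begin

text \<open>The walk is viewed as a Markov chain on pairs of the remaining environment and the position, so
  that all quantities are limits of functions defined by recursion on a finite time horizon.
  Excursions to the left of \<open>x\<close> return almost surely, because all drifts are nonnegative; erasing them,
  the visits to \<open>x\<close> depend only on the environment on \<open>[x, \<infinity>)\<close> and have the law of the visits to \<open>0\<close>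
  of the reflected walk in the shifted environment.

  Stopping the positive part of the walk at the hitting time of \<open>K\<close> gives
  \<open>K = (\<Sum>0<x<K. E[drift eaten at x]) + E[number of jumps from 0 to 1]\<close>. By stationarity the summands are
  \<open>g(K - x)\<close> with \<open>g\<close> increasing to \<open>E[D]\<close>, whence \<open>E[D] \<le> 1\<close>; and the last term is at most
  \<open>J + K P[at least J visits to 0]\<close>, whence \<open>E[D] \<ge> 1\<close> for a transient walk. A recurrent
  walk eats all cookies, so \<open>E[D] = E[\<delta>]\<close>. Recurrence at \<open>0\<close> implies recurrence at \<open>1\<close>, which makes its
  quenched probability monotone under the shift; ergodicity and a Levy-type argument at fresh sites turn
  this into a zero-one law.

  If the walk is transient and \<open>E[\<delta>] \<le> 1\<close>, then \<open>E[D] = E[\<delta>] = 1\<close>, so all drift present at \<open>0\<close> is eaten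
  almost surely; but a transient walk visits \<open>0\<close> only once with positive probability, so only the first
  cookie at \<open>0\<close> carries drift, and it must have strength \<open>1\<close>.\<close>

section \<open>The chain of remaining environment and position\<close>

text \<open>Removing the cookie just eaten makes environment and position jointly Markov. The site
  type is generic because the same recursion serves on \<open>int\<close> for the walk and on
  \<open>nat\<close> for its reflected version.\<close>

definition consume :: "('a \<Rightarrow> nat \<Rightarrow> real) \<Rightarrow> 'a \<Rightarrow> 'a \<Rightarrow> nat \<Rightarrow> real" where
  "consume \<omega> z = fun_upd \<omega> z (\<lambda>i. \<omega> z (Suc i))"

definition cookie_env :: "('a \<Rightarrow> nat \<Rightarrow> real) \<Rightarrow> bool" where
  "cookie_env \<omega> \<longleftrightarrow> (\<forall>z i. 1/2 \<le> \<omega> z i \<and> \<omega> z i \<le> 1)"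

lemma cookie_envD:
  assumes "cookie_env \<omega>"
  shows "1/2 \<le> \<omega> z i" "0 \<le> \<omega> z i" "\<omega> z i \<le> 1"
  using assms unfolding cookie_env_def by (auto intro: order_trans[of 0 "1/2"])

lemma cookie_env_consume: "cookie_env \<omega> \<Longrightarrow> cookie_env (consume \<omega> z)"
  by (auto simp: cookie_env_def consume_def)

lemma consume_same [simp]: "consume \<omega> z z i = \<omega> z (Suc i)"
  and consume_other: "y \<noteq> z \<Longrightarrow> consume \<omega> z y = \<omega> y"
  by (auto simp: consume_def)

text \<open>Probability of at least \<open>J\<close> visits to \<open>x\<close> within \<open>n\<close> steps, for the walk started at \<open>z\<close> and stopped
  on \<open>S\<close>. On the natural numbers \<open>0 - 1 = 0\<close>, so there this is the walk reflected at \<open>0\<close>.\<close>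
fun visits :: "'a::{one,plus,minus} set \<Rightarrow> 'a \<Rightarrow> nat \<Rightarrow> nat \<Rightarrow> ('a \<Rightarrow> nat \<Rightarrow> real) \<Rightarrow> 'a \<Rightarrow> real" where
  "visits S x n 0 \<omega> z = 1"
| "visits S x 0 (Suc J) \<omega> z = 0"
| "visits S x (Suc n) (Suc J) \<omega> z =
     (if z \<in> S then 0
      else \<omega> z 0 * visits S x n (if z = x then J else Suc J) (consume \<omega> z) (z + 1)
         + (1 - \<omega> z 0) * visits S x n (if z = x then J else Suc J) (consume \<omega> z) (z - 1))"

definition visits_lim :: "'a::{one,plus,minus} set \<Rightarrow> 'a \<Rightarrow> nat \<Rightarrow> ('a \<Rightarrow> nat \<Rightarrow> real) \<Rightarrow> 'a \<Rightarrow> real" where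
  "visits_lim S x J \<omega> z = (SUP n. visits S x n J \<omega> z)"

lemma convex_comb_mono:
  fixes p :: real
  assumes "0 \<le> p" "p \<le> 1" "a \<le> a'" "b \<le> b'"
  shows "p * a + (1 - p) * b \<le> p * a' + (1 - p) * b'"
  using assms by (intro add_mono mult_left_mono) auto

text \<open>Source of the comparisons with simple random walk: a cookie of strength at least
  \<open>1/2\<close> can only favour the better right-hand outcome.\<close>

lemma mean_le_convex_comb:
  fixes p :: real
  assumes "1/2 \<le> p" "b \<le> a"
  shows "(a + b) / 2 \<le> p * a + (1 - p) * b"
proof -
  have "0 \<le> (p - 1/2) * (a - b)" using assms by simp
  then show ?thesis by (simp add: field_simps)
qed

lemma visits_nonneg: "cookie_env \<omega> \<Longrightarrow> 0 \<le> visits S x n J \<omega> z"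
proof (induction S x n J \<omega> z rule: visits.induct)
  case (3 S x n J \<omega> z)
  then show ?case by (auto simp: cookie_env_consume cookie_envD)
qed auto

lemma visits_le_1: "cookie_env \<omega> \<Longrightarrow> visits S x n J \<omega> z \<le> 1"
proof (induction S x n J \<omega> z rule: visits.induct)
  case (3 S x n J \<omega> z)
  let ?v = "visits S x n (if z = x then J else Suc J) (consume \<omega> z)"
  have "\<omega> z 0 * ?v (z+1) + (1 - \<omega> z 0) * ?v (z-1) \<le> \<omega> z 0 * 1 + (1 - \<omega> z 0) * 1"
    if "z \<notin> S" using 3 that by (intro convex_comb_mono) (auto simp: cookie_env_consume cookie_envD)
  then show ?case by auto
qed auto

lemma visits_Suc_le:
  assumes "cookie_env \<omega>" shows "visits S x n (Suc J) \<omega> z \<le> visits S x n J \<omega> z"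
  using assms
proof (induction S x n J \<omega> z rule: visits.induct)
  case (1 S x n \<omega> z)
  then show ?case by (simp add: visits_le_1)
next
  case (3 S x n J \<omega> z)
  then show ?case
    by (auto simp: cookie_env_consume cookie_envD intro!: convex_comb_mono)
qed auto

lemma visits_le_Suc_time:
  assumes "cookie_env \<omega>" shows "visits S x n J \<omega> z \<le> visits S x (Suc n) J \<omega> z"
  using assms
proof (induction S x n J \<omega> z rule: visits.induct)
  case (2 S x J \<omega> z)
  then show ?case using visits_nonneg[of \<omega> S x "Suc 0" "Suc J" z] by simp
next
  case (3 S x n J \<omega> z)
  show ?case
    unfolding visits.simps(3)[of S x "Suc n"] visits.simps(3)[of S x n]
    using 3 by (auto simp: cookie_env_consume cookie_envD simp del: visits.simps intro!: convex_comb_mono)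
qed auto

lemma visits_antimono_stop:
  assumes "cookie_env \<omega>" "S \<subseteq> S'" shows "visits S' x n J \<omega> z \<le> visits S x n J \<omega> z"
  using assms
proof (induction S x n J \<omega> z rule: visits.induct)
  case (3 S x n J \<omega> z)
  have "0 \<le> visits S x (Suc n) (Suc J) \<omega> z" by (rule visits_nonneg) fact
  with 3 show ?case
    by (auto simp: cookie_env_consume cookie_envD split: if_splits intro!: convex_comb_mono)
qed auto

lemma visits_eq_0: "n < J \<Longrightarrow> visits S x n J \<omega> z = 0"
  by (induction S x n J \<omega> z rule: visits.induct) auto

lemma visits_lim_tendsto:
  assumes "cookie_env \<omega>"
  shows "(\<lambda>n. visits S x n J \<omega> z) \<longlonglongrightarrow> visits_lim S x J \<omega> z"
  unfolding visits_lim_def using assms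
  by (intro LIMSEQ_incseq_SUP bdd_aboveI[where M=1] incseq_SucI)
     (auto simp: visits_le_1 visits_le_Suc_time)

lemma visits_le_lim: "cookie_env \<omega> \<Longrightarrow> visits S x n J \<omega> z \<le> visits_lim S x J \<omega> z"
  by (rule incseq_le[OF incseq_SucI visits_lim_tendsto]) (auto simp: visits_le_Suc_time)

lemma visits_lim_leI:
  assumes "cookie_env \<omega>" "\<And>n. visits S x n J \<omega> z \<le> c" shows "visits_lim S x J \<omega> z \<le> c"
  by (rule LIMSEQ_le_const2[OF visits_lim_tendsto]) (use assms in auto)

lemma visits_lim_nonneg: "cookie_env \<omega> \<Longrightarrow> 0 \<le> visits_lim S x J \<omega> z"
  using visits_le_lim visits_nonneg order_trans by blast

lemma visits_lim_le_1: "cookie_env \<omega> \<Longrightarrow> visits_lim S x J \<omega> z \<le> 1"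
  by (intro visits_lim_leI visits_le_1)

lemma visits_lim_0 [simp]: "visits_lim S x 0 \<omega> z = 1"
  by (simp add: visits_lim_def)

lemma visits_lim_Suc_le: "cookie_env \<omega> \<Longrightarrow> visits_lim S x (Suc J) \<omega> z \<le> visits_lim S x J \<omega> z"
  by (rule LIMSEQ_le[OF visits_lim_tendsto visits_lim_tendsto]) (auto simp: visits_Suc_le)

lemma visits_lim_antimono: "cookie_env \<omega> \<Longrightarrow> I \<le> J \<Longrightarrow> visits_lim S x J \<omega> z \<le> visits_lim S x I \<omega> z"
  by (rule lift_Suc_antimono_le[of "\<lambda>J. visits_lim S x J \<omega> z"]) (auto simp: visits_lim_Suc_le)

lemma visits_lim_antimono_stop:
  "cookie_env \<omega> \<Longrightarrow> S \<subseteq> S' \<Longrightarrow> visits_lim S' x J \<omega> z \<le> visits_lim S x J \<omega> z"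
  by (rule LIMSEQ_le[OF visits_lim_tendsto visits_lim_tendsto]) (auto simp: visits_antimono_stop)

lemma visits_lim_step:
  assumes "cookie_env \<omega>" "z \<notin> S"
  shows "visits_lim S x (Suc J) \<omega> z =
      \<omega> z 0 * visits_lim S x (if z = x then J else Suc J) (consume \<omega> z) (z + 1)
    + (1 - \<omega> z 0) * visits_lim S x (if z = x then J else Suc J) (consume \<omega> z) (z - 1)" (is "_ = ?R")
proof (rule LIMSEQ_unique)
  show "(\<lambda>n. visits S x (Suc n) (Suc J) \<omega> z) \<longlonglongrightarrow> visits_lim S x (Suc J) \<omega> z"
    by (rule LIMSEQ_Suc[OF visits_lim_tendsto]) fact
  show "(\<lambda>n. visits S x (Suc n) (Suc J) \<omega> z) \<longlonglongrightarrow> ?R"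
    using assms by (auto intro!: tendsto_intros visits_lim_tendsto cookie_env_consume)
qed

text \<open>Probability that simple random walk on the integers moves from \<open>d\<close> to \<open>0\<close> within \<open>m\<close> steps.\<close>
fun srw_hit :: "nat \<Rightarrow> nat \<Rightarrow> real" where
  "srw_hit m 0 = 1"
| "srw_hit 0 (Suc d) = 0"
| "srw_hit (Suc m) (Suc d) = (srw_hit m d + srw_hit m (Suc (Suc d))) / 2"

lemma srw_hit_nonneg: "0 \<le> srw_hit m d"
  by (induction m d rule: srw_hit.induct) auto

lemma srw_hit_le_1: "srw_hit m d \<le> 1"
  by (induction m d rule: srw_hit.induct) auto

lemma srw_hit_Suc_le: "srw_hit m (Suc d) \<le> srw_hit m d"
proof (induction m arbitrary: d)
  case 0 then show ?case by (cases d) auto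
next
  case (Suc m)
  have "srw_hit m (Suc 0) \<le> 1" "srw_hit m (Suc (Suc 0)) \<le> 1" by (rule srw_hit_le_1)+
  with Suc.IH show ?case by (cases d) (auto intro!: add_mono)
qed

lemma srw_hit_le_Suc: "srw_hit m d \<le> srw_hit (Suc m) d"
proof (induction m d rule: srw_hit.induct)
  case (2 d) then show ?case by (simp add: srw_hit_nonneg)
next
  case (3 m d)
  then show ?case unfolding srw_hit.simps(3) by (intro divide_right_mono add_mono) auto
qed auto

text \<open>The limit is a bounded function of \<open>d\<close> that is harmonic, hence affine, hence constant.\<close>
lemma srw_hit_tendsto_1: "(\<lambda>m. srw_hit m d) \<longlonglongrightarrow> 1"
proof -
  define f where "f d = (SUP m. srw_hit m d)" for d
  have lim: "(\<lambda>m. srw_hit m d) \<longlonglongrightarrow> f d" for d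
    unfolding f_def
    by (intro LIMSEQ_incseq_SUP bdd_aboveI[where M=1] incseq_SucI) (auto simp: srw_hit_le_1 srw_hit_le_Suc)
  have f0: "f 0 = 1" by (simp add: f_def)
  have harm: "f (Suc d) = (f d + f (Suc (Suc d))) / 2" for d
  proof (rule LIMSEQ_unique[OF LIMSEQ_Suc[OF lim]])
    show "(\<lambda>m. srw_hit (Suc m) (Suc d)) \<longlonglongrightarrow> (f d + f (Suc (Suc d))) / 2"
      by (auto intro!: tendsto_intros lim)
  qed
  have aff: "f d = 1 + d * (f 1 - 1) \<and> f (Suc d) = 1 + Suc d * (f 1 - 1)" for d
  proof (induction d)
    case 0 show ?case using f0 by simp
  next
    case (Suc d) with harm[of d] show ?case by (auto simp: algebra_simps)
  qed
  have nn: "0 \<le> f d" for d by (rule LIMSEQ_le_const[OF lim]) (auto simp: srw_hit_nonneg)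
  have le: "f d \<le> 1" for d by (rule LIMSEQ_le_const2[OF lim]) (auto simp: srw_hit_le_1)
  have "f 1 = 1"
  proof (rule ccontr)
    assume "f 1 \<noteq> 1"
    with le[of 1] have p: "1 - f 1 > 0" by simp
    then obtain d :: nat where "1 < d * (1 - f 1)" using ex_less_of_nat_mult by blast
    with aff[of d] nn[of d] show False by (simp add: algebra_simps)
  qed
  with aff[of d] lim[of d] show ?thesis by simp
qed

section \<open>Erasing excursions to the left\<close>

text \<open>An excursion below \<open>x\<close> returns to \<open>x\<close> almost surely and leaves the environment on
  \<open>[x, \<infinity>)\<close> untouched, so it can be erased: what remains is the chain on the natural numbers,
  where truncated subtraction reflects the walk at \<open>0\<close>.\<close>

definition env_from :: "int \<Rightarrow> env \<Rightarrow> nat \<Rightarrow> nat \<Rightarrow> real" where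
  "env_from x \<omega> = (\<lambda>j. \<omega> (x + int j))"

lemma cookie_env_from: "cookie_env \<omega> \<Longrightarrow> cookie_env (env_from x \<omega>)"
  by (auto simp: cookie_env_def env_from_def)

lemma env_from_consume_below: "z < x \<Longrightarrow> env_from x (consume \<omega> z) = env_from x \<omega>"
  by (auto simp: env_from_def consume_def)

lemma env_from_consume: "x \<le> z \<Longrightarrow> env_from x (consume \<omega> z) = consume (env_from x \<omega>) (nat (z - x))"
  by (auto simp: env_from_def consume_def fun_eq_iff)

lemma env_from_nat: "x \<le> z \<Longrightarrow> env_from x \<omega> (nat (z - x)) = \<omega> z"
  by (simp add: env_from_def)

text \<open>Below \<open>x\<close> the map \<open>nat (z - x)\<close> is constantly \<open>0\<close>
  and eating cookies does not change \<open>env_from x\<close>, so both outcomes of a step have the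
  same bound. From \<open>x\<close> on the two recursions agree; a step from \<open>x\<close> to
  \<open>x - 1\<close> becomes the truncated step from \<open>0\<close> to \<open>0\<close>.\<close>

lemma visits_le_reflected:
  assumes "cookie_env \<omega>" "\<And>z. x \<le> z \<Longrightarrow> z \<in> S \<longleftrightarrow> nat (z - x) \<in> S'"
  shows "visits S x n J \<omega> z \<le> visits_lim S' 0 J (env_from x \<omega>) (nat (z - x))"
  using assms
proof (induction n arbitrary: J \<omega> z)
  case 0
  then show ?case by (cases J) (auto intro: visits_lim_nonneg cookie_env_from)
next
  case (Suc n)
  note env = \<open>cookie_env \<omega>\<close>
  note IH = Suc.IH[OF cookie_env_consume[OF env, of z] Suc.prems(2)]
  show ?case
  proof (cases J)
    case J: (Suc I)
    consider "z < x" | "x \<le> z" "z \<in> S" | "x \<le> z" "z \<notin> S" by linarith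
    then show ?thesis
    proof cases
      case 1
      let ?c = "visits_lim S' 0 J (env_from x \<omega>) 0"
      have c: "visits S x n J (consume \<omega> z) (z + 1) \<le> ?c" "visits S x n J (consume \<omega> z) (z - 1) \<le> ?c"
        using IH[of J "z+1"] IH[of J "z-1"] 1 by (simp_all add: env_from_consume_below)
      have "visits S x (Suc n) J \<omega> z \<le> \<omega> z 0 * ?c + (1 - \<omega> z 0) * ?c"
        using 1 J c convex_comb_mono[OF cookie_envD(2,3)[OF env] c, of z 0] env
        by (auto intro: visits_lim_nonneg cookie_env_from simp flip: distrib_right)
      then show ?thesis using 1 by (simp flip: distrib_right)
    next
      case 2
      then show ?thesis using J env by (auto intro: visits_lim_nonneg cookie_env_from)
    next
      case 3
      let ?z = "nat (z - x)"
      have nz: "nat (z + 1 - x) = ?z + 1" "nat (z - 1 - x) = ?z - 1" "?z = 0 \<longleftrightarrow> z = x" "?z \<notin> S'"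
        using 3 Suc.prems(2)[of z] by auto
      show ?thesis
        using 3 J nz env_from_nat[of x z \<omega>] visits_lim_step[OF cookie_env_from[OF env, of x] nz(4), of 0 I]
          IH[of I "z+1"] IH[of I "z-1"] IH[of J "z+1"] IH[of J "z-1"]
        by (auto simp: env_from_consume intro!: convex_comb_mono cookie_envD[OF env])
    qed
  qed simp
qed

text \<open>The converse needs that no path is lost below \<open>x\<close>: with cookies of strength
  at least \<open>1/2\<close> the climb back to \<open>x\<close> is at least as likely as for simple
  random walk, which returns almost surely. Hence the hypothesis that nothing below \<open>x\<close>
  is stopped.\<close>

lemma reflected_le_visits_lim:
  assumes "cookie_env \<omega>" "\<And>z. x \<le> z \<Longrightarrow> z \<in> S \<longleftrightarrow> nat (z - x) \<in> S'" "\<And>z. z < x \<Longrightarrow> z \<notin> S"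
  shows "visits S' 0 n J (env_from x \<omega>) (nat (z - x)) \<le> visits_lim S x J \<omega> z"
  using assms(1)
proof (induction n arbitrary: J \<omega> z)
  case 0
  then show ?case by (cases J) (auto intro: visits_lim_nonneg)
next
  case (Suc n)
  show ?case
  proof (cases J)
    case J: (Suc I)
    have ge: "visits S' 0 (Suc n) J (env_from x \<omega>) (nat (z - x)) \<le> visits_lim S x J \<omega> z"
      if env: "cookie_env \<omega>" and z: "x \<le> z" for \<omega> z
    proof (cases "z \<in> S")
      case True
      then show ?thesis using assms(2)[OF z] J env by (auto intro: visits_lim_nonneg)
    next
      case False
      let ?z = "nat (z - x)"
      have nz: "nat (z + 1 - x) = ?z + 1" "nat (z - 1 - x) = ?z - 1" "?z = 0 \<longleftrightarrow> z = x" "?z \<notin> S'"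
        using z False assms(2)[of z] by auto
      note IH = Suc.IH[OF cookie_env_consume[OF env, of z]]
      show ?thesis
        using z J nz env_from_nat[of x z \<omega>] visits_lim_step[OF env False, of x I]
          IH[of I "z+1"] IH[of I "z-1"] IH[of J "z+1"] IH[of J "z-1"]
        by (auto simp: env_from_consume intro!: convex_comb_mono cookie_envD[OF env])
    qed
    show ?thesis
    proof (cases "x \<le> z")
      case False
      \<comment> \<open>The lower bound granted on arrival at \<open>x\<close>. It depends on the
        environment only through \<open>env_from x\<close>, which the excursion leaves
        unchanged.\<close>
      define c where "c = visits S' 0 (Suc n) J (env_from x \<omega>) 0"
      have c0: "0 \<le> c" unfolding c_def by (intro visits_nonneg cookie_env_from Suc.prems)
      \<comment> \<open>Induction along simple random walk: from depth \<open>d\<close> the walk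
        arrives at \<open>x\<close> within \<open>m\<close> steps with probability at least
        \<open>srw_hit m d\<close>. Then \<open>m\<close> tends to infinity.\<close>
      have hit: "c * srw_hit m d \<le> visits_lim S x J \<omega>' (x - int d)"
        if "cookie_env \<omega>'" "env_from x \<omega>' = env_from x \<omega>" for m d \<omega>'
        using that
      proof (induction m d arbitrary: \<omega>' rule: srw_hit.induct)
        case (1 m)
        then show ?case using ge[of \<omega>' x] by (simp add: c_def del: visits.simps)
      next
        case (2 d)
        then show ?case by (auto intro: visits_lim_nonneg)
      next
        case (3 m d)
        define y where "y = x - int (Suc d)"
        have y: "y < x" "y + 1 = x - int d" "y - 1 = x - int (Suc (Suc d))" by (auto simp: y_def)
        have env': "cookie_env (consume \<omega>' y)" "env_from x (consume \<omega>' y) = env_from x \<omega>"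
          using 3 y by (auto simp: cookie_env_consume env_from_consume_below)
        let ?p = "\<omega>' y 0"
        have p: "1/2 \<le> ?p" "0 \<le> ?p" "?p \<le> 1" using cookie_envD[OF 3(3)] by auto
        have "srw_hit m (Suc (Suc d)) \<le> srw_hit m d"
          using srw_hit_Suc_le[of m d] srw_hit_Suc_le[of m "Suc d"] by simp
        then have "srw_hit (Suc m) (Suc d) \<le> ?p * srw_hit m d + (1 - ?p) * srw_hit m (Suc (Suc d))"
          unfolding srw_hit.simps(3) using p by (intro mean_le_convex_comb)
        from mult_left_mono[OF this c0]
        have "c * srw_hit (Suc m) (Suc d)
            \<le> ?p * (c * srw_hit m d) + (1 - ?p) * (c * srw_hit m (Suc (Suc d)))"
          unfolding distrib_left by (simp only: mult.left_commute)
        also have "\<dots> \<le> ?p * visits_lim S x J (consume \<omega>' y) (y + 1)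
            + (1 - ?p) * visits_lim S x J (consume \<omega>' y) (y - 1)"
          using 3(1,2)[OF env'] p by (intro convex_comb_mono) (auto simp: y)
        also have "\<dots> = visits_lim S x J \<omega>' y"
          using visits_lim_step[OF 3(3) assms(3)[OF y(1)], of x I] J y(1) by simp
        finally show ?case by (simp add: y_def)
      qed
      have "c * 1 \<le> visits_lim S x J \<omega> z"
        by (rule LIMSEQ_le_const2[OF tendsto_mult_left[OF srw_hit_tendsto_1[of "nat (x - z)"]]])
           (use hit[OF Suc.prems refl, of _ "nat (x - z)"] False in auto)
      then show ?thesis using False by (simp add: c_def del: visits.simps)
    qed (use ge Suc.prems in auto)
  qed simp
qed

lemma visits_lim_reflected:
  assumes "cookie_env \<omega>" "\<And>z. x \<le> z \<Longrightarrow> z \<in> S \<longleftrightarrow> nat (z - x) \<in> S'" "\<And>z. z < x \<Longrightarrow> z \<notin> S"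
  shows "visits_lim S x J \<omega> z = visits_lim S' 0 J (env_from x \<omega>) (nat (z - x))"
  using assms
  by (intro antisym visits_lim_leI visits_le_reflected reflected_le_visits_lim cookie_env_from) auto

section \<open>The quenched law of the walk\<close>

lemma walk_prefix_ne [simp]: "walk_prefix \<omega> x u n \<noteq> []"
  by (cases n) (auto simp: Let_def)

text \<open>Prepending one visit to \<open>z\<close> raises the visit count at \<open>z\<close>
  alone by one, which is exactly the index shift made by \<open>consume\<close>.\<close>

lemma walk_extend_Cons:
  assumes "ys \<noteq> []"
  shows "(let xs = z # ys; y = last xs; k = length (filter (\<lambda>v. v = y) (butlast xs))
          in xs @ [if s < \<omega> y k then y + 1 else y - 1 :: int])
       = z # (let xs = ys; y = last xs; k = length (filter (\<lambda>v. v = y) (butlast xs))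
          in xs @ [if s < consume \<omega> z y k then y + 1 else y - 1])"
  using assms by (auto simp: Let_def consume_def)

text \<open>\<open>walk_prefix\<close> grows at its end, whereas \<open>visits\<close> recurses on
  the first step; this equation is the Markov property that links the two.\<close>

lemma walk_prefix_Suc_Cons:
  "walk_prefix \<omega> z u (Suc n) =
    z # walk_prefix (consume \<omega> z) (if u 0 < \<omega> z 0 then z + 1 else z - 1) (\<lambda>i. u (Suc i)) n"
proof (induction n)
  case 0
  then show ?case by simp
next
  case (Suc n)
  show ?case
    unfolding walk_prefix.simps(2)[of \<omega> z u "Suc n"] Suc.IH
    by (subst walk_extend_Cons) simp_all
qed

lemma walk_0: "walk \<omega> z u 0 = z"
  by (simp add: walk_def)

lemma walk_Suc:
  "walk \<omega> z u (Suc n) = walk (consume \<omega> z) (if u 0 < \<omega> z 0 then z + 1 else z - 1) (\<lambda>i. u (Suc i)) n"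
  by (simp add: walk_def walk_prefix_Suc_Cons del: walk_prefix.simps(2))

lemma card_visit_times_Suc:
  "card {m. m < Suc n \<and> P m} = (if P 0 then 1 else 0) + card {m. m < n \<and> P (Suc m)}"
proof -
  have "{m. m < Suc n \<and> P m} = (if P 0 then {0} else {}) \<union> Suc ` {m. m < n \<and> P (Suc m)}"
    by (auto simp: image_iff less_Suc_eq_0_disj)
  then show ?thesis
    by (auto simp: card_insert_if card_image)
qed

lemma visit_count_Suc:
  "card {m. m < Suc n \<and> walk \<omega> z u m = x} = (if z = x then 1 else 0) +
     card {m. m < n \<and> walk (consume \<omega> z) (if u 0 < \<omega> z 0 then z + 1 else z - 1) (\<lambda>i. u (Suc i)) m = x}"
  by (simp add: card_visit_times_Suc[of n "\<lambda>m. walk \<omega> z u m = x"] walk_0 walk_Suc)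

section \<open>The driving uniform variables and measurability of the walk\<close>

interpretation unif: prob_space "uniform_measure lborel {0..1::real}"
  by (rule prob_space_uniform_measure) auto

interpretation unif_seq: sequence_space "uniform_measure lborel {0..1::real}"
  by unfold_locales

lemma sets_unif_seq: "sets unif_seq = sets (\<Pi>\<^sub>M n\<in>(UNIV::nat set). (borel :: real measure))"
  unfolding unif_seq_def by (rule sets_PiM_cong) auto

lemma prob_space_unif_seq: "prob_space unif_seq"
  unfolding unif_seq_def by unfold_locales

lemma emeasure_unif_less:
  assumes "0 \<le> p" "p \<le> 1"
  shows "emeasure (uniform_measure lborel {0..1::real}) {s. s < p} = ennreal p"
    "emeasure (uniform_measure lborel {0..1::real}) {s. \<not> s < p} = ennreal (1 - p)"
proof -
  have "{0..1} \<inter> {s. s < p} = {0..<p}" "{0..1} \<inter> {s. \<not> s < p} = {p..1}"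
    using assms by auto
  then show "emeasure (uniform_measure lborel {0..1::real}) {s. s < p} = ennreal p"
    "emeasure (uniform_measure lborel {0..1::real}) {s. \<not> s < p} = ennreal (1 - p)"
    using assms by (simp_all add: emeasure_uniform_measure not_less divide_ennreal_def)
qed

lemma measurable_component_unif_seq [measurable]: "(\<lambda>u. u i) \<in> borel_measurable unif_seq"
  by (subst measurable_cong_sets[OF sets_unif_seq refl]) (rule measurable_component_singleton, simp)

lemma measurable_tail_unif_seq [measurable]: "(\<lambda>u i. u (Suc i)) \<in> measurable unif_seq unif_seq"
  unfolding measurable_cong_sets[OF refl sets_unif_seq]
  by (rule measurable_PiM_single') (auto simp: space_PiM)

lemma measurable_walk_n [measurable]: "(\<lambda>u. walk \<omega> z u n) \<in> measurable unif_seq (count_space UNIV)"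
proof (induction n arbitrary: \<omega> z)
  case 0
  then show ?case by (simp add: walk_0)
next
  case (Suc n)
  have *: "(\<lambda>u. walk \<omega>' z' (\<lambda>i. u (Suc i)) n) \<in> measurable unif_seq (count_space UNIV)" for \<omega>' z'
    using measurable_compose[OF measurable_tail_unif_seq Suc] .
  have "(\<lambda>u. walk \<omega> z u (Suc n)) = (\<lambda>u. if u 0 < \<omega> z 0 then walk (consume \<omega> z) (z+1) (\<lambda>i. u (Suc i)) n
     else walk (consume \<omega> z) (z-1) (\<lambda>i. u (Suc i)) n)"
    by (auto simp: walk_Suc)
  also have "\<dots> \<in> measurable unif_seq (count_space UNIV)"
    using * by measurable
  finally show ?case .
qed

lemma measurable_walk [measurable]: "walk \<omega> z \<in> measurable unif_seq path_space"
  unfolding path_space_def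
  by (rule measurable_PiM_single') (auto simp: space_PiM measurable_walk_n)

lemma measurable_visit_count [measurable]:
  "(\<lambda>X. card {m. m < n \<and> X m = (x::int)}) \<in> measurable path_space (count_space UNIV)"
proof -
  have [measurable]: "(\<lambda>X. X m) \<in> measurable path_space (count_space UNIV)" for m
    unfolding path_space_def by (rule measurable_component_singleton) simp
  have "(\<lambda>X. card {m. m < n \<and> X m = (x::int)}) = (\<lambda>X. \<Sum>m<n. if X m = x then 1 else 0)"
    by (auto simp: fun_eq_iff sum.If_cases Int_def)
  then show ?thesis by simp
qed

text \<open>Identifies the recursion with an actual probability. The first uniform variable is split
  off as an independent factor and decides the first jump; the induction hypothesis applies to the
  walk driven by the rest in the consumed environment.\<close>

lemma emeasure_visit_count:
  assumes "cookie_env \<omega>"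
  shows "emeasure unif_seq {u \<in> space unif_seq. J \<le> card {m. m < n \<and> walk \<omega> z u m = x}}
    = ennreal (visits {} x n J \<omega> z)"
  using assms
proof (induction n arbitrary: \<omega> z J)
  case 0
  then show ?case by (cases J) (auto simp: prob_space.emeasure_space_1[OF prob_space_unif_seq])
next
  case (Suc n)
  interpret U: prob_space unif_seq by (rule prob_space_unif_seq)
  show ?case
  proof (cases J)
    case 0
    then show ?thesis by (simp add: U.emeasure_space_1)
  next
    case J: (Suc I)
    define J' where "J' = (if z = x then I else J)"
    let ?U = "uniform_measure lborel {0..1::real}"
    let ?\<omega> = "consume \<omega> z" and ?p = "\<omega> z 0"
    define B where "B y = {u \<in> space unif_seq. J' \<le> card {m. m < n \<and> walk ?\<omega> y u m = x}}" for y
    have B_sets [measurable]: "B y \<in> sets unif_seq" for y unfolding B_def by measurable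
    define A where "A = {u \<in> space unif_seq. J \<le> card {m. m < Suc n \<and> walk \<omega> z u m = x}}"
    have A [measurable]: "A \<in> sets unif_seq" unfolding A_def by measurable
    have B: "emeasure unif_seq (B y) = ennreal (visits {} x n J' ?\<omega> y)" for y
      unfolding B_def by (rule Suc.IH) (rule cookie_env_consume, fact)
    have p: "0 \<le> ?p" "?p \<le> 1" using Suc.prems by (auto intro: cookie_envD)
    have cons: "(\<lambda>(s, u). case_nat s u) \<in> measurable (?U \<Otimes>\<^sub>M unif_seq) unif_seq"
      unfolding unif_seq_def by measurable
    have "emeasure unif_seq A = emeasure (distr (?U \<Otimes>\<^sub>M unif_seq) unif_seq (\<lambda>(s, u). case_nat s u)) A"
      unfolding unif_seq_def using unif_seq.PiM_iter by simp
    also have "\<dots> = emeasure (?U \<Otimes>\<^sub>M unif_seq)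
        ((\<lambda>(s, u). case_nat s u) -` A \<inter> space (?U \<Otimes>\<^sub>M unif_seq))"
      by (rule emeasure_distr[OF cons A])
    also have "(\<lambda>(s, u). case_nat s u) -` A \<inter> space (?U \<Otimes>\<^sub>M unif_seq)
        = {s. s < ?p} \<times> B (z + 1) \<union> {s. \<not> s < ?p} \<times> B (z - 1)"
      using J by (auto simp: A_def B_def visit_count_Suc J'_def space_pair_measure unif_seq_def space_PiM
          simp del: not_less split: if_splits)
    also have "emeasure (?U \<Otimes>\<^sub>M unif_seq) \<dots> =
        emeasure (?U \<Otimes>\<^sub>M unif_seq) ({s. s < ?p} \<times> B (z + 1)) + emeasure (?U \<Otimes>\<^sub>M unif_seq) ({s. \<not> s < ?p} \<times> B (z - 1))"
      by (rule plus_emeasure[symmetric]) auto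
    also have "\<dots> = ennreal ?p * ennreal (visits {} x n J' ?\<omega> (z + 1))
        + ennreal (1 - ?p) * ennreal (visits {} x n J' ?\<omega> (z - 1))"
      by (simp add: U.emeasure_pair_measure_Times emeasure_unif_less[OF p] B del: not_less)
    also have "\<dots> = ennreal (visits {} x (Suc n) J \<omega> z)"
      using J p visits_nonneg[OF cookie_env_consume[OF Suc.prems]]
      by (simp add: J'_def ennreal_mult ennreal_plus)
    finally show ?thesis by (simp add: A_def)
  qed
qed

lemma cookie_env_space: "\<omega> \<in> space env_space \<Longrightarrow> cookie_env \<omega>"
  by (auto simp: env_space_def space_PiM space_restrict_space cookie_env_def PiE_def Pi_def)

lemma cookie_env_space_nonneg: "\<omega> \<in> space env_space_nonneg \<longleftrightarrow> cookie_env \<omega>"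
  by (auto simp: env_space_nonneg_def space_PiM space_restrict_space cookie_env_def PiE_def Pi_def)

lemma prob_space_quenched: "prob_space (quenched \<omega> z)"
  unfolding quenched_def by (rule prob_space.prob_space_distr[OF prob_space_unif_seq measurable_walk])

lemma sets_quenched [measurable_cong]: "sets (quenched \<omega> z) = sets path_space"
  by (simp add: quenched_def)

lemma visit_count_sets: "{X :: nat \<Rightarrow> int. J \<le> card {m. m < n \<and> X m = x}} \<in> sets path_space"
proof -
  have "(\<lambda>X. card {m. m < n \<and> X m = x}) -` {J..} \<inter> space path_space \<in> sets path_space"
    by (rule measurable_sets[OF measurable_visit_count]) simp
  also have "(\<lambda>X. card {m. m < n \<and> X m = x}) -` {J..} \<inter> space path_space = {X. J \<le> card {m. m < n \<and> X m = x}}"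
    by (auto simp: path_space_def space_PiM)
  finally show ?thesis .
qed

lemma emeasure_quenched_visits:
  assumes "cookie_env \<omega>"
  shows "emeasure (quenched \<omega> z) {X. J \<le> card {m. m < n \<and> X m = x}} = ennreal (visits {} x n J \<omega> z)"
proof -
  have "emeasure (quenched \<omega> z) {X. J \<le> card {m. m < n \<and> X m = x}}
     = emeasure unif_seq (walk \<omega> z -` {X. J \<le> card {m. m < n \<and> X m = x}} \<inter> space unif_seq)"
    unfolding quenched_def by (rule emeasure_distr[OF measurable_walk visit_count_sets])
  also have "walk \<omega> z -` {X. J \<le> card {m. m < n \<and> X m = x}} \<inter> space unif_seq
     = {u \<in> space unif_seq. J \<le> card {m. m < n \<and> walk \<omega> z u m = x}}"
    by blast
  finally show ?thesis by (simp only: emeasure_visit_count[OF assms])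
qed

section \<open>Visits over the whole time axis\<close>

definition many_visits :: "int \<Rightarrow> nat \<Rightarrow> (nat \<Rightarrow> int) set" where
  "many_visits x J = {X. \<exists>n. J \<le> card {m. m < n \<and> X m = x}}"

lemma many_visits_eq: "many_visits x J = (\<Union>n. {X. J \<le> card {m. m < n \<and> X m = x}})"
  unfolding many_visits_def by blast

lemma many_visits_sets: "many_visits x J \<in> sets path_space"
  unfolding many_visits_eq by (intro sets.countable_UN) (auto intro: visit_count_sets)

lemma emeasure_many_visits:
  assumes "cookie_env \<omega>"
  shows "emeasure (quenched \<omega> z) (many_visits x J) = ennreal (visits_lim {} x J \<omega> z)"
proof (rule LIMSEQ_unique)
  let ?A = "\<lambda>n. {X :: nat \<Rightarrow> int. J \<le> card {m. m < n \<and> X m = (x::int)}}"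
  have A: "range ?A \<subseteq> sets (quenched \<omega> z)"
    unfolding sets_quenched using visit_count_sets by blast
  have "incseq ?A"
  proof (rule incseq_SucI, rule subsetI)
    fix n :: nat and X :: "nat \<Rightarrow> int" assume "X \<in> ?A n"
    moreover have "card {m. m < n \<and> X m = x} \<le> card {m. m < Suc n \<and> X m = x}"
      by (intro card_mono) auto
    ultimately show "X \<in> ?A (Suc n)" by auto
  qed
  then show "(\<lambda>n. ennreal (visits {} x n J \<omega> z)) \<longlonglongrightarrow> emeasure (quenched \<omega> z) (many_visits x J)"
    unfolding many_visits_eq emeasure_quenched_visits[OF assms, symmetric]
    using A by (intro Lim_emeasure_incseq)
  show "(\<lambda>n. ennreal (visits {} x n J \<omega> z)) \<longlonglongrightarrow> ennreal (visits_lim {} x J \<omega> z)"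
    by (intro tendsto_ennrealI visits_lim_tendsto assms)
qed

text \<open>The cookie with index \<open>i\<close> is eaten exactly when at least
  \<open>Suc i\<close> visits take place. This turns the limiting drift into a series that can be
  integrated term by term.\<close>

lemma drift_inf_eq:
  assumes "cookie_env \<omega>"
  shows "drift_inf \<omega> x X = (\<Sum>i. ennreal (2 * \<omega> x i - 1) * indicator (many_visits x (Suc i)) X)"
proof -
  let ?d = "\<lambda>i. ennreal (2 * \<omega> x i - 1)"
  define N where "N n = card {m. m < n \<and> X m = x}" for n
  have mono: "N m \<le> N n" if "m \<le> n" for m n
    unfolding N_def using that by (intro card_mono) auto
  have drift: "ennreal (drift_n \<omega> x X n) = (\<Sum>i<N n. ?d i)" for n
    unfolding drift_n_def N_def using cookie_envD(1)[OF assms, of x]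
    by (subst sum_ennreal) (auto simp: field_simps)
  have ind: "indicator (many_visits x (Suc i)) X = (if \<exists>n. i < N n then 1 else (0::ennreal))" for i
    by (auto simp: many_visits_def N_def indicator_def Suc_le_eq)
  show ?thesis
    unfolding drift_inf_def drift ind
  proof (rule antisym)
    show "(SUP n. sum ?d {..<N n}) \<le> (\<Sum>i. ?d i * (if \<exists>n. i < N n then 1 else 0))"
    proof (rule SUP_least)
      fix n
      have "sum ?d {..<N n} = (\<Sum>i<N n. ?d i * (if \<exists>n. i < N n then 1 else 0))"
        by (intro sum.cong) auto
      also have "\<dots> \<le> (\<Sum>i. ?d i * (if \<exists>n. i < N n then 1 else 0))"
        by (rule sum_le_suminf) auto
      finally show "sum ?d {..<N n} \<le> \<dots>" .
    qed
    show "(\<Sum>i. ?d i * (if \<exists>n. i < N n then 1 else 0)) \<le> (SUP n. sum ?d {..<N n})"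
      unfolding suminf_eq_SUP
    proof (rule SUP_least)
      fix k
      let ?I = "{i. i < k \<and> (\<exists>n. i < N n)}"
      have "\<exists>n. \<forall>i\<in>?I. i < N n"
      proof (induction k)
        case (Suc k)
        then obtain n where n: "\<forall>i\<in>{i. i < k \<and> (\<exists>n. i < N n)}. i < N n" by auto
        show ?case
        proof (cases "\<exists>n. k < N n")
          case True
          then obtain n' where "k < N n'" by auto
          then have "\<forall>i\<in>{i. i < Suc k \<and> (\<exists>n. i < N n)}. i < N n'" by auto
          then show ?thesis by blast
        next
          case False
          with n show ?thesis by (auto simp: less_Suc_eq)
        qed
      qed auto
      then obtain n where n: "\<forall>i\<in>?I. i < N n" ..
      have "(\<Sum>i<k. ?d i * (if \<exists>n. i < N n then 1 else 0)) = sum ?d ?I"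
        by (rule sum.mono_neutral_cong_right) auto
      also have "\<dots> \<le> sum ?d {..<N n}" using n by (intro sum_mono2) auto
      also have "\<dots> \<le> (SUP n. sum ?d {..<N n})" by (rule SUP_upper) simp
      finally show "(\<Sum>i<k. ?d i * (if \<exists>n. i < N n then 1 else 0)) \<le> \<dots>" .
    qed
  qed
qed

lemma nn_integral_drift_inf:
  assumes "cookie_env \<omega>"
  shows "(\<integral>\<^sup>+ X. drift_inf \<omega> x X \<partial>quenched \<omega> z) = (\<Sum>i. ennreal ((2 * \<omega> x i - 1) * visits_lim {} x (Suc i) \<omega> z))"
proof -
  have sets: "many_visits x J \<in> sets (quenched \<omega> z)" for J
    by (simp add: sets_quenched many_visits_sets)
  have "(\<integral>\<^sup>+ X. drift_inf \<omega> x X \<partial>quenched \<omega> z)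
     = (\<Sum>i. \<integral>\<^sup>+ X. ennreal (2 * \<omega> x i - 1) * indicator (many_visits x (Suc i)) X \<partial>quenched \<omega> z)"
    unfolding drift_inf_eq[OF assms]
    by (rule nn_integral_suminf) (intro borel_measurable_times_ennreal borel_measurable_indicator borel_measurable_const sets)
  also have "\<dots> = (\<Sum>i. ennreal ((2 * \<omega> x i - 1) * visits_lim {} x (Suc i) \<omega> z))"
  proof (rule suminf_cong)
    fix i
    have "0 \<le> 2 * \<omega> x i - 1" using cookie_envD(1)[OF assms, of x i] by simp
    then show "(\<integral>\<^sup>+ X. ennreal (2 * \<omega> x i - 1) * indicator (many_visits x (Suc i)) X \<partial>quenched \<omega> z)
        = ennreal ((2 * \<omega> x i - 1) * visits_lim {} x (Suc i) \<omega> z)"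
      by (simp add: nn_integral_cmult_indicator sets emeasure_many_visits[OF assms] ennreal_mult'
        visits_lim_nonneg[OF assms])
  qed
  finally show ?thesis .
qed

lemma R_event_eq: "R_event x = (\<Inter>J. many_visits x J)"
proof -
  have "infinite {n. X n = x} \<longleftrightarrow> (\<forall>J. \<exists>n. J \<le> card {m. m < n \<and> X m = x})" for X :: "nat \<Rightarrow> int"
  proof
    assume inf: "infinite {n. X n = x}"
    show "\<forall>J. \<exists>n. J \<le> card {m. m < n \<and> X m = x}"
    proof
      fix J
      obtain T where T: "T \<subseteq> {n. X n = x}" "finite T" "card T = J"
        using infinite_arbitrarily_large[OF inf] by blast
      then have "T \<subseteq> {m. m < Suc (Max T) \<and> X m = x}" by (auto simp: less_Suc_eq_le)
      then have "card T \<le> card {m. m < Suc (Max T) \<and> X m = x}" by (intro card_mono) auto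
      with T show "\<exists>n. J \<le> card {m. m < n \<and> X m = x}" by blast
    qed
  next
    assume J: "\<forall>J. \<exists>n. J \<le> card {m. m < n \<and> X m = x}"
    show "infinite {n. X n = x}"
    proof
      assume fin: "finite {n. X n = x}"
      obtain n where n: "Suc (card {n. X n = x}) \<le> card {m. m < n \<and> X m = x}" using J by blast
      have "card {m. m < n \<and> X m = x} \<le> card {n. X n = x}" by (intro card_mono fin) auto
      with n show False by simp
    qed
  qed
  then show ?thesis by (auto simp: R_event_def many_visits_def)
qed

definition inf_visits :: "'a::{one,plus,minus} \<Rightarrow> ('a \<Rightarrow> nat \<Rightarrow> real) \<Rightarrow> 'a \<Rightarrow> real" where
  "inf_visits x \<omega> z = (INF J. visits_lim {} x J \<omega> z)"

lemma inf_visits_tendsto: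
  assumes "cookie_env \<omega>"
  shows "(\<lambda>J. visits_lim {} x J \<omega> z) \<longlonglongrightarrow> inf_visits x \<omega> z"
  unfolding inf_visits_def using assms
  by (intro LIMSEQ_decseq_INF bdd_belowI[where m=0] decseq_SucI)
     (auto simp: visits_lim_nonneg visits_lim_Suc_le)

lemma measure_R_event:
  assumes "cookie_env \<omega>"
  shows "measure (quenched \<omega> z) (R_event x) = inf_visits x \<omega> z"
proof (rule LIMSEQ_unique)
  interpret prob_space "quenched \<omega> z" by (rule prob_space_quenched)
  have "decseq (many_visits x)"
    unfolding many_visits_def by (rule decseq_SucI) (auto intro: Suc_leD)
  then have "(\<lambda>J. measure (quenched \<omega> z) (many_visits x J)) \<longlonglongrightarrow> measure (quenched \<omega> z) (\<Inter>J. many_visits x J)"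
    by (intro finite_Lim_measure_decseq) (auto simp: sets_quenched many_visits_sets)
  then show "(\<lambda>J. visits_lim {} x J \<omega> z) \<longlonglongrightarrow> measure (quenched \<omega> z) (R_event x)"
    using assms by (simp add: R_event_eq measure_def emeasure_many_visits visits_lim_nonneg)
qed (rule inf_visits_tendsto, fact)

section \<open>Optional stopping at level \<open>K\<close>\<close>

text \<open>With \<open>c p = 2 * p - 1\<close> this is the expected drift eaten at \<open>x\<close>
  in \<open>n\<close> steps, with \<open>c p = p\<close> the expected number of jumps from
  \<open>x\<close> to \<open>x + 1\<close>. Indices from \<open>n\<close> on are left out because
  \<open>n\<close> steps eat at most \<open>n\<close> cookies.\<close>

definition site_sum :: "(real \<Rightarrow> real) \<Rightarrow> int set \<Rightarrow> int \<Rightarrow> nat \<Rightarrow> env \<Rightarrow> int \<Rightarrow> real" where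
  "site_sum c S x n \<omega> z = (\<Sum>i<n. c (\<omega> x i) * visits S x n (Suc i) \<omega> z)"

lemma site_sum_stopped: "z \<in> S \<Longrightarrow> site_sum c S x n \<omega> z = 0"
  by (cases n) (simp_all add: site_sum_def)

text \<open>If \<open>z = x\<close>, the cookie with index \<open>0\<close> is certainly eaten and
  the other summands are reindexed; otherwise the last summand vanishes, as \<open>n\<close>
  remaining steps cannot contain \<open>Suc n\<close> visits.\<close>

lemma site_sum_step:
  assumes "z \<notin> S"
  shows "site_sum c S x (Suc n) \<omega> z = (if z = x then c (\<omega> x 0) else 0)
    + (\<omega> z 0 * site_sum c S x n (consume \<omega> z) (z + 1) + (1 - \<omega> z 0) * site_sum c S x n (consume \<omega> z) (z - 1))"
proof (cases "z = x")
  case True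
  have "site_sum c S x (Suc n) \<omega> z = c (\<omega> x 0) + (\<Sum>i<n. c (\<omega> x (Suc i)) * visits S x (Suc n) (Suc (Suc i)) \<omega> z)"
    unfolding site_sum_def sum.lessThan_Suc_shift using assms True by simp
  also have "(\<Sum>i<n. c (\<omega> x (Suc i)) * visits S x (Suc n) (Suc (Suc i)) \<omega> z)
    = \<omega> z 0 * site_sum c S x n (consume \<omega> z) (z + 1) + (1 - \<omega> z 0) * site_sum c S x n (consume \<omega> z) (z - 1)"
    unfolding site_sum_def sum_distrib_left sum.distrib[symmetric] using assms True
    by (intro sum.cong) (simp_all add: algebra_simps)
  finally show ?thesis using True by simp
next
  case False
  have "site_sum c S x (Suc n) \<omega> z = (\<Sum>i<n. c (\<omega> x i) * visits S x (Suc n) (Suc i) \<omega> z)"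
    unfolding site_sum_def sum.lessThan_Suc using assms False by (simp add: visits_eq_0)
  also have "\<dots> = \<omega> z 0 * site_sum c S x n (consume \<omega> z) (z + 1) + (1 - \<omega> z 0) * site_sum c S x n (consume \<omega> z) (z - 1)"
    unfolding site_sum_def sum_distrib_left sum.distrib[symmetric] using assms False
    by (intro sum.cong) (simp_all add: algebra_simps consume_other)
  finally show ?thesis using False by simp
qed

text \<open>Expectation of the positive part of the walk started at \<open>z\<close>, stopped on \<open>[K, \<infinity>)\<close>, after \<open>n\<close> steps.\<close>
fun pos_height :: "int \<Rightarrow> nat \<Rightarrow> env \<Rightarrow> int \<Rightarrow> real" where
  "pos_height K 0 \<omega> z = max 0 (real_of_int z)"
| "pos_height K (Suc n) \<omega> z =
     (if K \<le> z then max 0 (real_of_int z)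
      else \<omega> z 0 * pos_height K n (consume \<omega> z) (z + 1) + (1 - \<omega> z 0) * pos_height K n (consume \<omega> z) (z - 1))"

lemma pos_height_le: "cookie_env \<omega> \<Longrightarrow> z \<le> K \<Longrightarrow> 0 \<le> K \<Longrightarrow> pos_height K n \<omega> z \<le> K"
proof (induction n arbitrary: \<omega> z)
  case (Suc n)
  then have "\<omega> z 0 * pos_height K n (consume \<omega> z) (z + 1) + (1 - \<omega> z 0) * pos_height K n (consume \<omega> z) (z - 1)
      \<le> \<omega> z 0 * K + (1 - \<omega> z 0) * K" if "z < K"
    using that by (intro convex_comb_mono) (auto simp: cookie_env_consume cookie_envD)
  with Suc.prems show ?case by (auto simp: algebra_simps)
qed auto

text \<open>Reaching \<open>K\<close> contributes height \<open>K\<close>, all other paths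
  contribute at least \<open>0\<close>, and the walk reaches \<open>K\<close> at least as easily as
  simple random walk does.\<close>

lemma pos_height_ge_srw_hit:
  "cookie_env \<omega> \<Longrightarrow> 0 \<le> K \<Longrightarrow> K * srw_hit n d \<le> pos_height K n \<omega> (K - int d)"
proof (induction n d arbitrary: \<omega> rule: srw_hit.induct)
  case (1 n)
  then show ?case by (cases n) auto
next
  case (3 n d)
  define y where "y = K - int (Suc d)"
  have y: "y < K" "y + 1 = K - int d" "y - 1 = K - int (Suc (Suc d))" by (auto simp: y_def)
  have p: "1/2 \<le> \<omega> y 0" "0 \<le> \<omega> y 0" "\<omega> y 0 \<le> 1" using cookie_envD[OF 3(3)] by auto
  have "srw_hit n (Suc (Suc d)) \<le> srw_hit n d"
    using srw_hit_Suc_le[of n d] srw_hit_Suc_le[of n "Suc d"] by simp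
  then have "srw_hit (Suc n) (Suc d) \<le> \<omega> y 0 * srw_hit n d + (1 - \<omega> y 0) * srw_hit n (Suc (Suc d))"
    unfolding srw_hit.simps(3) using p by (intro mean_le_convex_comb)
  from mult_left_mono[OF this, of K] have "K * srw_hit (Suc n) (Suc d)
      \<le> \<omega> y 0 * (K * srw_hit n d) + (1 - \<omega> y 0) * (K * srw_hit n (Suc (Suc d)))"
    unfolding distrib_left using 3(4) by (simp only: mult.left_commute of_int_0_le_iff)
  also have "\<dots> \<le> \<omega> y 0 * pos_height K n (consume \<omega> y) (y + 1) + (1 - \<omega> y 0) * pos_height K n (consume \<omega> y) (y - 1)"
    using 3(1,2)[OF cookie_env_consume[OF 3(3), of y] 3(4)] p by (intro convex_comb_mono) (auto simp: y)
  also have "\<dots> = pos_height K (Suc n) \<omega> y" using y(1) by simp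
  finally show ?case by (simp add: y_def)
qed auto

text \<open>Doob decomposition of the positive part. The mean increment of \<open>max 0 z\<close> is
  \<open>0\<close> for \<open>z < 0\<close>, \<open>p\<close> at \<open>z = 0\<close> and
  \<open>2 * p - 1\<close> for \<open>z > 0\<close>, where \<open>p\<close> is the cookie eaten;
  adding up the increments before stopping gives the two kinds of site sums.\<close>

lemma pos_height_eq:
  fixes K :: nat
  assumes "0 < K"
  shows "pos_height K n \<omega> z = max 0 (real_of_int z)
    + (site_sum (\<lambda>p. p) {int K..} 0 n \<omega> z + (\<Sum>x\<in>{1..<K}. site_sum (\<lambda>p. 2 * p - 1) {int K..} x n \<omega> z))"
proof (induction n arbitrary: \<omega> z)
  case 0
  then show ?case by (simp add: site_sum_def)
next
  case (Suc n)
  let ?S = "{int K..}" and ?d = "\<lambda>p. 2 * p - 1 :: real"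
  show ?case
  proof (cases "int K \<le> z")
    case True
    then show ?thesis by (simp add: site_sum_stopped)
  next
    case False
    let ?p = "\<omega> z 0" and ?\<omega> = "consume \<omega> z"
    have own: "(\<Sum>x\<in>{1..<K}. if z = int x then ?d (\<omega> x 0) else 0) = (if 0 < z then ?d ?p else 0)"
    proof (cases "0 < z")
      case True
      then have "(\<Sum>x\<in>{1..<K}. if z = int x then ?d (\<omega> x 0) else 0) = (\<Sum>x\<in>{1..<K}. if x = nat z then ?d (\<omega> x 0) else 0)"
        by (intro sum.cong) auto
      then show ?thesis using True False by (subst (asm) sum.delta) auto
    next
      case False
      then show ?thesis by (auto intro!: sum.neutral)
    qed
    have "(\<Sum>x\<in>{1..<K}. site_sum ?d ?S x (Suc n) \<omega> z) = (if 0 < z then ?d ?p else 0)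
        + (?p * (\<Sum>x\<in>{1..<K}. site_sum ?d ?S x n ?\<omega> (z + 1))
        + (1 - ?p) * (\<Sum>x\<in>{1..<K}. site_sum ?d ?S x n ?\<omega> (z - 1)))"
      using False by (simp add: site_sum_step sum.distrib sum_distrib_left own[symmetric])
    moreover have "pos_height K (Suc n) \<omega> z = ?p * pos_height K n ?\<omega> (z + 1) + (1 - ?p) * pos_height K n ?\<omega> (z - 1)"
      using False by simp
    moreover have "?p * max 0 (real_of_int (z + 1)) + (1 - ?p) * max 0 (real_of_int (z - 1))
      = max 0 (real_of_int z) + ((if z = 0 then ?p else 0) + (if 0 < z then ?d ?p else 0))"
    proof -
      consider "z < 0" | "z = 0" | "0 < z" by linarith
      then show ?thesis
      proof cases
        case 3
        then have "max 0 (real_of_int (z + 1)) = z + 1" "max 0 (real_of_int (z - 1)) = z - 1" "max 0 (real_of_int z) = z"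
          by auto
        with 3 show ?thesis by (simp add: algebra_simps)
      qed (auto simp: max_def)
    qed
    moreover have "site_sum (\<lambda>p. p) ?S 0 (Suc n) \<omega> z = (if z = 0 then ?p else 0)
      + (?p * site_sum (\<lambda>p. p) ?S 0 n ?\<omega> (z + 1) + (1 - ?p) * site_sum (\<lambda>p. p) ?S 0 n ?\<omega> (z - 1))"
      using False by (simp add: site_sum_step)
    ultimately show ?thesis unfolding Suc.IH by (simp add: algebra_simps)
  qed
qed

lemma site_sum_nonneg:
  assumes "cookie_env \<omega>" "\<And>p. 1/2 \<le> p \<Longrightarrow> p \<le> 1 \<Longrightarrow> 0 \<le> c p"
  shows "0 \<le> site_sum c S x n \<omega> z"
  unfolding site_sum_def using assms
  by (intro sum_nonneg mult_nonneg_nonneg visits_nonneg) (auto simp: cookie_env_def)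

text \<open>Each visit to \<open>0\<close> beyond the \<open>J\<close>-th happens only if \<open>J\<close> visits occur at all, and after
  those the expected number of jumps from \<open>0\<close> to \<open>1\<close> is still at most \<open>K\<close>.\<close>
lemma site_sum_le_visits:
  fixes K :: nat
  assumes "0 < K" "cookie_env \<omega>" "z \<le> int K"
  shows "site_sum (\<lambda>p. p) {int K..} 0 n \<omega> z \<le> J + K * visits {int K..} 0 n J \<omega> z"
  using assms(2,3)
proof (induction n arbitrary: J \<omega> z)
  case 0
  then show ?case by (simp add: site_sum_def visits_nonneg)
next
  case (Suc n)
  show ?case
  proof (cases J)
    case 0
    \<comment> \<open>All terms of \<open>pos_height_eq\<close> are nonnegative, so the expected
      number of jumps is at most the expected height, which is at most \<open>K\<close>.\<close>
    have "0 \<le> (\<Sum>x\<in>{1..<K}. site_sum (\<lambda>p. 2 * p - 1) {int K..} x (Suc n) \<omega> z)"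
      using Suc.prems by (intro sum_nonneg site_sum_nonneg) auto
    then have "site_sum (\<lambda>p. p) {int K..} 0 (Suc n) \<omega> z \<le> pos_height K (Suc n) \<omega> z"
      unfolding pos_height_eq[OF assms(1)] by linarith
    also have "\<dots> \<le> K" using pos_height_le[of \<omega> z "int K" "Suc n"] Suc.prems by simp
    finally show ?thesis using 0 by simp
  next
    case J: (Suc I)
    let ?p = "\<omega> z 0" and ?\<omega> = "consume \<omega> z"
    let ?v = "visits {int K..} 0 n (if z = 0 then I else J) ?\<omega>"
    let ?s = "site_sum (\<lambda>p. p) {int K..} 0 n ?\<omega>" and ?J = "if z = 0 then I else J"
    show ?thesis
    proof (cases "z = K")
      case True
      then show ?thesis using J by (simp add: site_sum_stopped)
    next
      case False
      then have z: "z < K" using Suc.prems by simp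
      have env: "cookie_env ?\<omega>" by (rule cookie_env_consume) fact
      have p: "0 \<le> ?p" "?p \<le> 1" using Suc.prems by (auto intro: cookie_envD)
      have "?p * ?s (z + 1) + (1 - ?p) * ?s (z - 1) \<le> ?p * (?J + K * ?v (z + 1)) + (1 - ?p) * (?J + K * ?v (z - 1))"
        using z by (intro convex_comb_mono p Suc.IH env) auto
      moreover have "\<dots> = ?J + K * (?p * ?v (z + 1) + (1 - ?p) * ?v (z - 1))"
        by (simp add: algebra_simps)
      moreover have "visits {int K..} 0 (Suc n) J \<omega> z = ?p * ?v (z + 1) + (1 - ?p) * ?v (z - 1)"
        using z J by simp
      moreover have "site_sum (\<lambda>p. p) {int K..} 0 (Suc n) \<omega> z = (if z = 0 then ?p else 0) + (?p * ?s (z + 1) + (1 - ?p) * ?s (z - 1))"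
        using z by (simp add: site_sum_step)
      \<comment> \<open>At \<open>z = 0\<close> the target drops from \<open>J\<close> to
        \<open>I\<close>; the \<open>1\<close> released in this way covers the jump, whose
        probability is at most \<open>1\<close>.\<close>
      ultimately show ?thesis using p J by (auto split: if_splits)
    qed
  qed
qed

text \<open>If \<open>\<rho>\<close> is the environment seen from a site \<open>x\<close>, this is
  also the drift eaten at \<open>x\<close> by the unreflected walk coming from the left, by
  \<open>visits_lim_reflected\<close>. The type \<open>ennreal\<close> allows for infinite total
  cookie strength.\<close>

definition expected_drift :: "nat set \<Rightarrow> (nat \<Rightarrow> nat \<Rightarrow> real) \<Rightarrow> ennreal" where
  "expected_drift S \<rho> = (\<Sum>i. ennreal ((2 * \<rho> 0 i - 1) * visits_lim S 0 (Suc i) \<rho> 0))"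

lemma drift_visits_nonneg: "cookie_env \<rho> \<Longrightarrow> 0 \<le> (2 * \<rho> y i - 1) * visits_lim S x J \<rho> z"
  using cookie_envD(1)[of \<rho> y i] by (intro mult_nonneg_nonneg visits_lim_nonneg) auto

text \<open>The start \<open>0\<close> lies at or left of \<open>x\<close>, so seen from
  \<open>x\<close> the truncated start is again \<open>0\<close>; stopping at level \<open>K\<close>
  becomes stopping at distance \<open>K - x\<close>.\<close>

lemma site_sum_le_expected_drift:
  assumes "cookie_env \<omega>" "x < K"
  shows "ennreal (site_sum (\<lambda>p. 2 * p - 1) {int K..} (int x) n \<omega> 0) \<le> expected_drift {K - x..} (env_from (int x) \<omega>)"
proof -
  let ?\<rho> = "env_from (int x) \<omega>"
  have env: "cookie_env ?\<rho>" by (intro cookie_env_from assms)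
  have "site_sum (\<lambda>p. 2 * p - 1) {int K..} (int x) n \<omega> 0
      \<le> (\<Sum>i<n. (2 * ?\<rho> 0 i - 1) * visits_lim {K - x..} 0 (Suc i) ?\<rho> 0)"
    unfolding site_sum_def
  proof (rule sum_mono)
    fix i
    have "visits {int K..} (int x) n (Suc i) \<omega> 0 \<le> visits_lim {K - x..} 0 (Suc i) ?\<rho> (nat (0 - int x))"
      using assms by (intro visits_le_reflected) auto
    then show "(2 * \<omega> (int x) i - 1) * visits {int K..} (int x) n (Suc i) \<omega> 0
        \<le> (2 * ?\<rho> 0 i - 1) * visits_lim {K - x..} 0 (Suc i) ?\<rho> 0"
      using cookie_envD(1)[OF assms(1), of "int x" i] by (intro mult_mono) (auto simp: env_from_def visits_nonneg[OF assms(1)])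
  qed
  then have "ennreal (site_sum (\<lambda>p. 2 * p - 1) {int K..} (int x) n \<omega> 0)
      \<le> (\<Sum>i<n. ennreal ((2 * ?\<rho> 0 i - 1) * visits_lim {K - x..} 0 (Suc i) ?\<rho> 0))"
    by (subst sum_ennreal) (auto intro!: ennreal_leI drift_visits_nonneg env)
  also have "\<dots> \<le> expected_drift {K - x..} ?\<rho>"
    unfolding expected_drift_def by (rule sum_le_suminf) auto
  finally show ?thesis .
qed

text \<open>The height is at most \<open>K\<close> and the jump term in \<open>pos_height_eq\<close>
  is nonnegative, so the drift terms alone stay below \<open>K\<close>.\<close>

lemma sum_expected_drift_le:
  assumes "cookie_env \<omega>" "0 < K"
  shows "(\<Sum>x\<in>{1..<K}. expected_drift {K - x..} (env_from (int x) \<omega>)) \<le> of_nat K"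
proof -
  define a where "a x i = (2 * \<omega> (int x) i - 1) * visits_lim {int K..} (int x) (Suc i) \<omega> 0" for x i
  have a0: "0 \<le> a x i" for x i unfolding a_def by (rule drift_visits_nonneg) fact
  have "expected_drift {K - x..} (env_from (int x) \<omega>) = (\<Sum>i. ennreal (a x i))" if "x \<in> {1..<K}" for x
  proof -
    have "visits_lim {int K..} (int x) J \<omega> 0 = visits_lim {K - x..} 0 J (env_from (int x) \<omega>) (nat (0 - int x))" for J
      using assms that by (intro visits_lim_reflected) auto
    then show ?thesis by (simp add: expected_drift_def a_def env_from_def)
  qed
  then have "(\<Sum>x\<in>{1..<K}. expected_drift {K - x..} (env_from (int x) \<omega>)) = (\<Sum>x\<in>{1..<K}. \<Sum>i. ennreal (a x i))"
    by (intro sum.cong) auto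
  also have "\<dots> = (\<Sum>i. \<Sum>x\<in>{1..<K}. ennreal (a x i))"
    by (rule suminf_sum[symmetric]) auto
  also have "\<dots> = (\<Sum>i. ennreal (\<Sum>x\<in>{1..<K}. a x i))"
    using a0 by (simp add: sum_ennreal)
  also have "\<dots> \<le> of_nat K"
    unfolding suminf_eq_SUP
  proof (rule SUP_least)
    fix M
    have "(\<Sum>i<M. \<Sum>x\<in>{1..<K}. a x i) \<le> K"
    proof (rule LIMSEQ_le_const2)
      show "(\<lambda>n. \<Sum>i<M. \<Sum>x\<in>{1..<K}. (2 * \<omega> (int x) i - 1) * visits {int K..} (int x) n (Suc i) \<omega> 0)
          \<longlonglongrightarrow> (\<Sum>i<M. \<Sum>x\<in>{1..<K}. a x i)"
        unfolding a_def by (intro tendsto_sum tendsto_mult_left visits_lim_tendsto assms)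
      show "\<exists>N. \<forall>n\<ge>N. (\<Sum>i<M. \<Sum>x\<in>{1..<K}. (2 * \<omega> (int x) i - 1) * visits {int K..} (int x) n (Suc i) \<omega> 0) \<le> K"
      proof (intro exI allI impI)
        fix n assume "M \<le> n"
        have "(\<Sum>i<M. \<Sum>x\<in>{1..<K}. (2 * \<omega> (int x) i - 1) * visits {int K..} (int x) n (Suc i) \<omega> 0)
          = (\<Sum>x\<in>{1..<K}. \<Sum>i<M. (2 * \<omega> (int x) i - 1) * visits {int K..} (int x) n (Suc i) \<omega> 0)"
          by (rule sum.swap)
        also have "\<dots> \<le> (\<Sum>x\<in>{1..<K}. site_sum (\<lambda>p. 2 * p - 1) {int K..} x n \<omega> 0)"
          unfolding site_sum_def using \<open>M \<le> n\<close> cookie_envD(1)[OF assms(1)]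
          by (intro sum_mono sum_mono2 mult_nonneg_nonneg visits_nonneg assms) (auto simp: field_simps)
        also have "\<dots> \<le> pos_height K n \<omega> 0"
          unfolding pos_height_eq[OF assms(2)]
          using site_sum_nonneg[OF assms(1), of "\<lambda>p. p" "{int K..}" 0 n 0] by simp
        also have "\<dots> \<le> K" using pos_height_le[OF assms(1), of 0 "int K" n] by simp
        finally show "(\<Sum>i<M. \<Sum>x\<in>{1..<K}. (2 * \<omega> (int x) i - 1) * visits {int K..} (int x) n (Suc i) \<omega> 0) \<le> K" .
      qed
    qed
    then have "ennreal (\<Sum>i<M. \<Sum>x\<in>{1..<K}. a x i) \<le> ennreal K" by (rule ennreal_leI)
    then show "(\<Sum>i<M. ennreal (\<Sum>x\<in>{1..<K}. a x i)) \<le> of_nat K"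
      using a0 by (simp add: sum_ennreal sum_nonneg ennreal_of_nat_eq_real_of_nat)
  qed
  finally show ?thesis .
qed

text \<open>The counterpart: simple random walk, hence also this one, reaches \<open>K\<close>
  almost surely, so the expected height tends to \<open>K\<close>, and
  \<open>site_sum_le_visits\<close> controls the jump term. The parameter \<open>J\<close> stays
  free, to be sent to infinity after \<open>K\<close>.\<close>

lemma le_sum_expected_drift:
  assumes "cookie_env \<omega>" "0 < K"
  shows "of_nat K \<le> (\<Sum>x\<in>{1..<K}. expected_drift {K - x..} (env_from (int x) \<omega>))
    + (of_nat J + of_nat K * ennreal (visits_lim {} 0 J (env_from 0 \<omega>) 0))" (is "_ \<le> ?R")
proof (rule LIMSEQ_le_const2)
  have "(\<lambda>n. ennreal (K * srw_hit n K)) \<longlonglongrightarrow> ennreal (real K * 1)"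
    by (intro tendsto_ennrealI tendsto_mult_left srw_hit_tendsto_1)
  then show "(\<lambda>n. ennreal (K * srw_hit n K)) \<longlonglongrightarrow> of_nat K"
    by (simp add: ennreal_of_nat_eq_real_of_nat)
  let ?v = "visits_lim {} 0 J (env_from 0 \<omega>) 0"
  have "ennreal (K * srw_hit n K) \<le> ?R" for n
  proof -
    let ?s = "\<lambda>x::nat. site_sum (\<lambda>p. 2 * p - 1) {int K..} x n \<omega> 0"
    have s0: "0 \<le> ?s x" for x by (intro site_sum_nonneg assms) auto
    have v0: "0 \<le> ?v" by (intro visits_lim_nonneg cookie_env_from assms)
    have "visits {int K..} 0 n J \<omega> 0 \<le> visits {} 0 n J \<omega> 0"
      by (rule visits_antimono_stop) (use assms in auto)
    also have "\<dots> \<le> visits_lim {} 0 J (env_from 0 \<omega>) (nat (0 - 0))"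
      by (rule visits_le_reflected) (use assms in auto)
    finally have v: "visits {int K..} 0 n J \<omega> 0 \<le> ?v" by simp
    have "K * srw_hit n K \<le> pos_height K n \<omega> 0"
      using pos_height_ge_srw_hit[OF assms(1), of "int K" n K] by simp
    also have "\<dots> = site_sum (\<lambda>p. p) {int K..} 0 n \<omega> 0 + (\<Sum>x\<in>{1..<K}. ?s x)"
      unfolding pos_height_eq[OF assms(2)] by simp
    also have "\<dots> \<le> (\<Sum>x\<in>{1..<K}. ?s x) + (J + K * ?v)"
      using site_sum_le_visits[OF assms(2,1), of 0 n J] v mult_left_mono[OF v, of "real K"] by simp
    finally have "ennreal (K * srw_hit n K) \<le> ennreal ((\<Sum>x\<in>{1..<K}. ?s x) + (J + K * ?v))"
      by (rule ennreal_leI)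
    also have "\<dots> = (\<Sum>x\<in>{1..<K}. ennreal (?s x)) + (of_nat J + of_nat K * ennreal ?v)"
      using s0 v0 by (simp add: ennreal_plus sum_nonneg sum_ennreal ennreal_mult ennreal_of_nat_eq_real_of_nat)
    also have "\<dots> \<le> ?R"
      by (intro add_right_mono sum_mono site_sum_le_expected_drift assms) auto
    finally show ?thesis .
  qed
  then show "\<exists>N. \<forall>n\<ge>N. ennreal (K * srw_hit n K) \<le> ?R" by blast
qed

section \<open>Recurrence and the shift\<close>

lemma env_shift_consume_0: "env_shift (consume \<rho> 0) = env_shift \<rho>"
  by (auto simp: env_shift_def consume_def)

lemma env_shift_consume_Suc: "env_shift (consume \<rho> (Suc z)) = consume (env_shift \<rho>) z"
  by (auto simp: env_shift_def consume_def fun_eq_iff)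

lemma env_shift_app: "env_shift \<rho> z = \<rho> (Suc z)"
  by (simp add: env_shift_def)

lemma cookie_env_shift: "cookie_env \<rho> \<Longrightarrow> cookie_env (env_shift \<rho>)"
  by (auto simp: cookie_env_def env_shift_def)

lemma env_shift_pow: "(env_shift ^^ m) \<rho> = (\<lambda>j. \<rho> (m + j))"
  by (induction m) (auto simp: env_shift_def)

lemma cookie_env_shift_pow: "cookie_env \<rho> \<Longrightarrow> cookie_env ((env_shift ^^ m) \<rho>)"
  by (auto simp: cookie_env_def env_shift_pow)

lemma env_shift_pow_consume: "z < m \<Longrightarrow> (env_shift ^^ m) (consume \<rho> z) = (env_shift ^^ m) \<rho>"
  by (auto simp: env_shift_pow consume_def)

section \<open>The probability of infinitely many visits\<close>

lemma inf_visits_le_lim: "cookie_env \<omega> \<Longrightarrow> inf_visits x \<omega> z \<le> visits_lim {} x J \<omega> z"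
  by (rule decseq_ge[OF decseq_SucI inf_visits_tendsto]) (auto simp: visits_lim_Suc_le)

lemma inf_visits_nonneg: "cookie_env \<omega> \<Longrightarrow> 0 \<le> inf_visits x \<omega> z"
  by (rule LIMSEQ_le_const[OF inf_visits_tendsto]) (auto simp: visits_lim_nonneg)

lemma inf_visits_le_1: "cookie_env \<omega> \<Longrightarrow> inf_visits x \<omega> z \<le> 1"
  using inf_visits_le_lim[of \<omega> x z 0] by simp

lemma inf_visits_step:
  assumes "cookie_env \<omega>"
  shows "inf_visits x \<omega> z =
    \<omega> z 0 * inf_visits x (consume \<omega> z) (z + 1) + (1 - \<omega> z 0) * inf_visits x (consume \<omega> z) (z - 1)" (is "_ = ?R")
proof (rule LIMSEQ_unique)
  have env: "cookie_env (consume \<omega> z)" by (rule cookie_env_consume) fact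
  have lim: "(\<lambda>J. visits_lim {} x (if z = x then J else Suc J) (consume \<omega> z) y) \<longlonglongrightarrow> inf_visits x (consume \<omega> z) y" for y
    using inf_visits_tendsto[OF env, of x y] LIMSEQ_Suc[OF inf_visits_tendsto[OF env, of x y]] by (cases "z = x") auto
  show "(\<lambda>J. visits_lim {} x (Suc J) \<omega> z) \<longlonglongrightarrow> inf_visits x \<omega> z"
    by (intro LIMSEQ_Suc inf_visits_tendsto assms)
  show "(\<lambda>J. visits_lim {} x (Suc J) \<omega> z) \<longlonglongrightarrow> ?R"
    using visits_lim_step[OF assms, of z "{}" x] lim
    by (auto intro!: tendsto_intros)
qed

text \<open>Trivial cases of the inductions with an error term. For \<open>J = 0\<close> the main
  term is already \<open>1\<close>; for \<open>K = 0\<close> and \<open>J > 0\<close> the factor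
  \<open>2 ^ J\<close> outweighs \<open>g \<ge> 1/2\<close>.\<close>

lemma one_le_add_error:
  fixes V \<alpha> b g :: real
  assumes "J = 0 \<or> K = 0" "0 \<le> V" "J = 0 \<Longrightarrow> V = 1" "0 \<le> \<alpha>" "1 \<le> b" "1/2 \<le> g"
  shows "1 \<le> V + 2 ^ J * \<alpha> ^ K * b * g"
proof (cases J)
  case 0
  then show ?thesis using assms by simp
next
  case (Suc j)
  have "1 \<le> (2::real) ^ j" by simp
  also have "\<dots> = 2 ^ J * \<alpha> ^ K * 1 * (1/2)" using Suc assms(1) by simp
  also have "\<dots> \<le> 2 ^ J * \<alpha> ^ K * b * g" using assms by (intro mult_mono) auto
  finally show ?thesis using assms(2) by simp
qed

text \<open>At each visit to \<open>0\<close> the walk moves on to \<open>1\<close> with probability at least \<open>1/2\<close>, so \<open>K\<close>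
  visits to \<open>0\<close> with fewer than \<open>J\<close> visits to \<open>1\<close> are exponentially unlikely in \<open>K\<close>. The error
  term is a supersolution of the corresponding recursion.\<close>
lemma visits_le_shift:
  fixes \<rho> :: "nat \<Rightarrow> nat \<Rightarrow> real"
  assumes "cookie_env \<rho>"
  shows "visits {} 0 n K \<rho> z \<le> visits_lim {} 0 J (env_shift \<rho>) (z - 1) + 2 ^ J * (3/4) ^ K * (if z = 0 then 1 else 1/2)"
  using assms
proof (induction n arbitrary: K J \<rho> z)
  case 0
  have *: "0 \<le> visits_lim {} 0 J (env_shift \<rho>) (z - 1)" by (intro visits_lim_nonneg cookie_env_shift 0)
  with one_le_add_error[of J K "visits_lim {} 0 J (env_shift \<rho>) (z - 1)" "3/4" 1 "if z = 0 then 1 else 1/2"]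
  show ?case by (cases K; cases J) auto
next
  case (Suc n)
  note env = \<open>cookie_env \<rho>\<close>
  note env' = cookie_env_shift[OF env]
  have V0: "0 \<le> visits_lim {} 0 J (env_shift \<rho>) (z - 1)" by (intro visits_lim_nonneg env')
  show ?case
  proof (cases "J = 0 \<or> K = 0")
    case True
    have "visits {} 0 (Suc n) K \<rho> z \<le> 1" by (rule visits_le_1) fact
    moreover have "1 \<le> visits_lim {} 0 J (env_shift \<rho>) (z - 1) + 2 ^ J * (3/4) ^ K * (if z = 0 then 1 else 1/2)"
      using True V0 one_le_add_error[of J K "visits_lim {} 0 J (env_shift \<rho>) (z - 1)" "3/4" 1 "if z = 0 then 1 else 1/2"]
      by auto
    ultimately show ?thesis by linarith
  next
    case False
    then obtain J' K' where J: "J = Suc J'" and K: "K = Suc K'" by (metis not0_implies_Suc)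
    let ?p = "\<rho> z 0" and ?\<rho> = "consume \<rho> z"
    have p: "1/2 \<le> ?p" "0 \<le> ?p" "?p \<le> 1" using cookie_envD[OF env] by auto
    note IH = Suc.IH[OF cookie_env_consume[OF env, of z]]
    let ?e = "\<lambda>J K. 2 ^ J * (3/4) ^ K :: real"
    consider "z = 0" | "z = 1" | y where "z = Suc (Suc y)" by (metis One_nat_def old.nat.exhaust)
    then show ?thesis
    proof cases
      case 1
      let ?V = "visits_lim {} 0 J (env_shift \<rho>) 0"
      have "visits {} 0 (Suc n) K \<rho> z = ?p * visits {} 0 n K' ?\<rho> 1 + (1 - ?p) * visits {} 0 n K' ?\<rho> 0"
        using 1 K by simp
      also have "\<dots> \<le> ?p * (?V + ?e J K' / 2) + (1 - ?p) * (?V + ?e J K')"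
        using IH[of K' 1 J] IH[of K' 0 J] 1 by (intro convex_comb_mono p) (simp_all add: env_shift_consume_0)
      also have "\<dots> = ?V + ?e J K' * (1 - ?p / 2)" by (simp add: algebra_simps)
      \<comment> \<open>A move to \<open>1\<close> halves the weight and has probability at least
        \<open>1/2\<close>; the resulting factor of at most \<open>3/4\<close> accounts for the
        visit to \<open>0\<close>.\<close>
      also have "\<dots> \<le> ?V + ?e J K' * (3/4)" using p by (intro add_left_mono mult_left_mono) auto
      finally show ?thesis using 1 K by (simp add: mult_ac)
    next
      case 2
      let ?W = "\<lambda>y. visits_lim {} 0 J' (consume (env_shift \<rho>) 0) y"
      have "visits {} 0 (Suc n) K \<rho> z = ?p * visits {} 0 n K ?\<rho> 2 + (1 - ?p) * visits {} 0 n K ?\<rho> 0"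
        using 2 K by (simp add: numeral_2_eq_2)
      \<comment> \<open>Site \<open>1\<close> is the origin of the shifted environment: the visit
        lowers \<open>J\<close> to \<open>J'\<close>, and the factor \<open>2\<close> lost from
        \<open>2 ^ J\<close> makes up for the larger weight at \<open>0\<close>.\<close>
      also have "\<dots> \<le> ?p * (?W 1 + ?e J' K) + (1 - ?p) * (?W 0 + ?e J' K)"
      proof (intro convex_comb_mono p)
        have "0 \<le> ?e J' K" by simp
        moreover have "visits {} 0 n K ?\<rho> 2 \<le> ?W 1 + ?e J' K / 2"
          using IH[of K 2 J'] 2 by (simp add: env_shift_consume_Suc)
        ultimately show "visits {} 0 n K ?\<rho> 2 \<le> ?W 1 + ?e J' K" by linarith
        show "visits {} 0 n K ?\<rho> 0 \<le> ?W 0 + ?e J' K"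
          using IH[of K 0 J'] 2 by (simp add: env_shift_consume_Suc)
      qed
      also have "\<dots> = ?p * ?W 1 + (1 - ?p) * ?W 0 + ?e J' K" by (simp add: algebra_simps)
      also have "?p * ?W 1 + (1 - ?p) * ?W 0 = visits_lim {} 0 J (env_shift \<rho>) 0"
        using visits_lim_step[OF env', of 0 "{}" 0 J'] 2 J by (simp add: env_shift_app)
      finally show ?thesis using 2 J by simp
    next
      case 3
      let ?W = "visits_lim {} 0 J (consume (env_shift \<rho>) (Suc y))"
      have "visits {} 0 (Suc n) K \<rho> z = ?p * visits {} 0 n K ?\<rho> (Suc z) + (1 - ?p) * visits {} 0 n K ?\<rho> (Suc y)"
        using 3 K by simp
      also have "\<dots> \<le> ?p * (?W z + ?e J K / 2) + (1 - ?p) * (?W y + ?e J K / 2)"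
        using IH[of K "Suc z" J] IH[of K "Suc y" J] 3
        by (intro convex_comb_mono p) (simp_all add: env_shift_consume_Suc)
      also have "\<dots> = ?p * ?W z + (1 - ?p) * ?W y + ?e J K / 2" by (simp add: field_simps)
      also have "?p * ?W z + (1 - ?p) * ?W y = visits_lim {} 0 J (env_shift \<rho>) (Suc y)"
        using visits_lim_step[OF env', of "Suc y" "{}" 0 J'] 3 J by (simp add: env_shift_app)
      finally show ?thesis using 3 J by simp
    qed
  qed
qed

text \<open>First \<open>K\<close>, then \<open>J\<close> tends to infinity in
  \<open>visits_le_shift\<close>: infinitely many visits to \<open>0\<close> force infinitely many
  to \<open>1\<close>, and right of \<open>0\<close> the walk is the one in the shifted
  environment.\<close>

lemma inf_visits_le_shift:
  fixes \<rho> :: "nat \<Rightarrow> nat \<Rightarrow> real"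
  assumes "cookie_env \<rho>"
  shows "inf_visits 0 \<rho> z \<le> inf_visits 0 (env_shift \<rho>) (z - 1)"
proof (rule LIMSEQ_le_const[OF inf_visits_tendsto[OF cookie_env_shift[OF assms]]])
  have "inf_visits 0 \<rho> z \<le> visits_lim {} 0 J (env_shift \<rho>) (z - 1)" for J
  proof (rule LIMSEQ_le_const)
    have "(\<lambda>K. (3/4::real) ^ K) \<longlonglongrightarrow> 0" by (rule LIMSEQ_realpow_zero) auto
    from tendsto_add[OF tendsto_const tendsto_mult[OF tendsto_mult[OF tendsto_const this] tendsto_const]]
    have "(\<lambda>K. visits_lim {} 0 J (env_shift \<rho>) (z - 1) + 2 ^ J * (3/4) ^ K * (if z = 0 then 1 else 1/2))
        \<longlonglongrightarrow> visits_lim {} 0 J (env_shift \<rho>) (z - 1) + 2 ^ J * 0 * (if z = 0 then 1 else 1/2)" .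
    then show "(\<lambda>K. visits_lim {} 0 J (env_shift \<rho>) (z - 1) + 2 ^ J * (3/4) ^ K * (if z = 0 then 1 else 1/2))
        \<longlonglongrightarrow> visits_lim {} 0 J (env_shift \<rho>) (z - 1)" by simp
    have "inf_visits 0 \<rho> z \<le> visits_lim {} 0 J (env_shift \<rho>) (z - 1) + 2 ^ J * (3/4) ^ K * (if z = 0 then 1 else 1/2)" for K
      using inf_visits_le_lim[OF assms, of 0 z K] visits_lim_leI[OF assms visits_le_shift[OF assms], of K z J] by linarith
    then show "\<exists>N. \<forall>K\<ge>N. inf_visits 0 \<rho> z \<le> visits_lim {} 0 J (env_shift \<rho>) (z - 1) + 2 ^ J * (3/4) ^ K * (if z = 0 then 1 else 1/2)"
      by blast
  qed
  then show "\<exists>N. \<forall>J\<ge>N. inf_visits 0 \<rho> z \<le> visits_lim {} 0 J (env_shift \<rho>) (z - 1)" by blast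
qed

lemma inf_visits_le_shift_pow:
  fixes \<rho> :: "nat \<Rightarrow> nat \<Rightarrow> real"
  assumes "cookie_env \<rho>"
  shows "inf_visits 0 \<rho> z \<le> inf_visits 0 ((env_shift ^^ m) \<rho>) (z - m)"
proof (induction m)
  case (Suc m)
  also have "inf_visits 0 ((env_shift ^^ m) \<rho>) (z - m) \<le> inf_visits 0 ((env_shift ^^ Suc m) \<rho>) (z - m - 1)"
    using inf_visits_le_shift[OF cookie_env_shift_pow[OF assms], of m "z - m"] by simp
  finally show ?case by simp
qed simp

text \<open>The zero-one argument: as the walk reaches a fresh site \<open>m\<close>, the conditional probability
  of recurrence is at most that of recurrence in the environment seen from \<open>m\<close>.\<close>
lemma inf_visits_le_visits:
  fixes \<rho> :: "nat \<Rightarrow> nat \<Rightarrow> real"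
  assumes "cookie_env \<rho>" "z + n \<le> m"
  shows "inf_visits 0 \<rho> z + (1 - inf_visits 0 ((env_shift ^^ m) \<rho>) 0) * visits {} 0 n J \<rho> z \<le> visits_lim {} 0 J \<rho> z"
  using assms
proof (induction n arbitrary: J \<rho> z)
  case 0
  then show ?case
    using inf_visits_le_shift_pow[of \<rho> z m] inf_visits_le_lim[of \<rho> 0 z J] by (cases J) auto
next
  case (Suc n)
  note env = \<open>cookie_env \<rho>\<close>
  show ?case
  proof (cases J)
    case 0
    then show ?thesis using inf_visits_le_shift_pow[OF env, of z m] Suc.prems by simp
  next
    case J: (Suc I)
    let ?p = "\<rho> z 0" and ?\<rho> = "consume \<rho> z" and ?I = "if z = 0 then I else J"
    let ?c = "1 - inf_visits 0 ((env_shift ^^ m) \<rho>) 0"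
    \<comment> \<open>As \<open>z + Suc n \<le> m\<close>, site \<open>z\<close> lies left of
      \<open>m\<close>. Eating there does not alter the environment seen from \<open>m\<close>, so
      the coefficient \<open>?c\<close> is constant along the induction.\<close>
    have c: "(env_shift ^^ m) ?\<rho> = (env_shift ^^ m) \<rho>"
      using Suc.prems by (intro env_shift_pow_consume) simp
    note IH = Suc.IH[OF cookie_env_consume[OF env, of z], unfolded c]
    have "inf_visits 0 \<rho> z + ?c * visits {} 0 (Suc n) J \<rho> z
      = ?p * (inf_visits 0 ?\<rho> (z + 1) + ?c * visits {} 0 n ?I ?\<rho> (z + 1))
      + (1 - ?p) * (inf_visits 0 ?\<rho> (z - 1) + ?c * visits {} 0 n ?I ?\<rho> (z - 1))"
      unfolding inf_visits_step[OF env, of 0 z] J visits.simps by (simp add: algebra_simps)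
    also have "\<dots> \<le> ?p * visits_lim {} 0 ?I ?\<rho> (z + 1) + (1 - ?p) * visits_lim {} 0 ?I ?\<rho> (z - 1)"
      using Suc.prems cookie_envD[OF env] by (intro convex_comb_mono IH) auto
    also have "\<dots> = visits_lim {} 0 J \<rho> z"
      using visits_lim_step[OF env, of z "{}" 0 I] J by simp
    finally show ?thesis .
  qed
qed

text \<open>In \<open>inf_visits_le_visits\<close> take \<open>m = n\<close>, so that the fresh site
  recedes with the horizon, and let \<open>n\<close>, then \<open>J\<close>, tend to infinity. For
  \<open>c < 1\<close> the conclusion forces the probability to be \<open>0\<close>.\<close>

lemma inf_visits_zero_one:
  fixes \<rho> :: "nat \<Rightarrow> nat \<Rightarrow> real"
  assumes "cookie_env \<rho>" "\<And>m. inf_visits 0 ((env_shift ^^ m) \<rho>) 0 \<le> c"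
  shows "inf_visits 0 \<rho> 0 \<le> c * inf_visits 0 \<rho> 0"
proof -
  let ?q = "inf_visits 0 \<rho> 0"
  have *: "?q + (1 - c) * visits_lim {} 0 J \<rho> 0 \<le> visits_lim {} 0 J \<rho> 0" for J
  proof (rule LIMSEQ_le_const2)
    show "(\<lambda>n. ?q + (1 - c) * visits {} 0 n J \<rho> 0) \<longlonglongrightarrow> ?q + (1 - c) * visits_lim {} 0 J \<rho> 0"
      by (intro tendsto_intros visits_lim_tendsto assms)
    have "?q + (1 - c) * visits {} 0 n J \<rho> 0 \<le> visits_lim {} 0 J \<rho> 0" for n
      using inf_visits_le_visits[OF assms(1), of 0 n n J]
        mult_right_mono[of "1 - c" "1 - inf_visits 0 ((env_shift ^^ n) \<rho>) 0" "visits {} 0 n J \<rho> 0"]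
        assms(2)[of n] visits_nonneg[OF assms(1), of "{}" 0 n J 0] by simp
    then show "\<exists>N. \<forall>n\<ge>N. ?q + (1 - c) * visits {} 0 n J \<rho> 0 \<le> visits_lim {} 0 J \<rho> 0" by blast
  qed
  have "?q + (1 - c) * ?q \<le> ?q"
  proof (rule LIMSEQ_le)
    show "(\<lambda>J. ?q + (1 - c) * visits_lim {} 0 J \<rho> 0) \<longlonglongrightarrow> ?q + (1 - c) * ?q"
      by (intro tendsto_intros inf_visits_tendsto assms)
    show "(\<lambda>J. visits_lim {} 0 J \<rho> 0) \<longlonglongrightarrow> ?q" by (intro inf_visits_tendsto assms)
  qed (use * in blast)
  then show ?thesis by (simp add: algebra_simps)
qed

text \<open>Conversely, once the cookies at \<open>1\<close> are bounded away from \<open>1\<close>, many visits to \<open>1\<close> entail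
  many visits to \<open>0\<close>. The factor \<open>(8/7) ^ e\<close> pays for the first \<open>e\<close> cookies at \<open>1\<close>.\<close>
lemma visits_shift_le:
  fixes \<rho> :: "nat \<Rightarrow> nat \<Rightarrow> real"
  assumes "cookie_env \<rho>" "\<And>i. e \<le> i \<Longrightarrow> \<rho> 1 i \<le> 3/4"
  shows "visits {} 0 n K (env_shift \<rho>) (z - 1) \<le> visits_lim {} 0 J \<rho> z + 2 ^ J * (7/8) ^ K * (8/7) ^ e * (if z = 0 then 1/2 else 1)"
  using assms
proof (induction n arbitrary: J K e \<rho> z)
  case 0
  have V: "0 \<le> visits_lim {} 0 J \<rho> z" by (intro visits_lim_nonneg 0)
  with one_le_add_error[of J K "visits_lim {} 0 J \<rho> z" "7/8" "(8/7) ^ e" "if z = 0 then 1/2 else 1"]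
  show ?case by (cases K; cases J) auto
next
  case (Suc n)
  let ?E = "\<lambda>J K e. 2 ^ J * (7/8) ^ K * (8/7) ^ e :: real"
  have E0: "0 \<le> ?E J K e" for J K e by simp
  have triv: "visits {} 0 (Suc n) K (env_shift \<rho>) y \<le> visits_lim {} 0 J \<rho> z + ?E J K e * (if z = 0 then 1/2 else 1)"
    if env: "cookie_env \<rho>" and "J = 0 \<or> K = 0" for \<rho> :: "nat \<Rightarrow> nat \<Rightarrow> real" and J K e y z
  proof -
    have V: "0 \<le> visits_lim {} 0 J \<rho> z" by (intro visits_lim_nonneg env)
    have "1 \<le> visits_lim {} 0 J \<rho> z + ?E J K e * (if z = 0 then 1/2 else 1)"
      using that V by (intro one_le_add_error) auto
    moreover have "visits {} 0 (Suc n) K (env_shift \<rho>) y \<le> 1" by (intro visits_le_1 cookie_env_shift env)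
    ultimately show ?thesis by linarith
  qed
  have pos: "visits {} 0 (Suc n) K (env_shift \<rho>) (z - 1) \<le> visits_lim {} 0 J \<rho> z + ?E J K e"
    if env: "cookie_env \<rho>" and e: "\<And>i. e \<le> i \<Longrightarrow> \<rho> 1 i \<le> 3/4" and z: "0 < z"
    for \<rho> :: "nat \<Rightarrow> nat \<Rightarrow> real" and J K e z
  proof (cases "J = 0 \<or> K = 0")
    case True
    then show ?thesis using triv[OF env, of J K "z - 1" z e] z by simp
  next
    case False
    then obtain J' K' where J: "J = Suc J'" and K: "K = Suc K'" by (metis not0_implies_Suc)
    let ?p = "\<rho> z 0" and ?\<rho> = "consume \<rho> z"
    have p: "1/2 \<le> ?p" "0 \<le> ?p" "?p \<le> 1" using cookie_envD[OF env] by auto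
    consider "z = 1" | y where "z = Suc (Suc y)" using z by (metis One_nat_def old.nat.exhaust less_irrefl)
    then show ?thesis
    proof cases
      case 1
      let ?V = "visits_lim {} 0 J ?\<rho>" and ?E' = "?E J K' (e - 1)"
      note IH = Suc.IH[OF cookie_env_consume[OF env, of z], of "e - 1"]
      have e': "?\<rho> 1 i \<le> 3/4" if "e - 1 \<le> i" for i using e[of "Suc i"] that 1 by simp
      have "visits {} 0 (Suc n) K (env_shift \<rho>) 0
          = ?p * visits {} 0 n K' (env_shift ?\<rho>) 1 + (1 - ?p) * visits {} 0 n K' (env_shift ?\<rho>) 0"
        using 1 K by (simp add: env_shift_app env_shift_consume_Suc)
      also have "\<dots> \<le> ?p * (?V 2 + ?E') + (1 - ?p) * (?V 0 + ?E' / 2)"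
        using IH[OF e', of K' 2 J] IH[OF e', of K' 0 J] by (intro convex_comb_mono p) simp_all
      also have "\<dots> = (?p * ?V 2 + (1 - ?p) * ?V 0) + ?E' * ((1 + ?p) / 2)" by (simp add: field_simps)
      also have "?p * ?V 2 + (1 - ?p) * ?V 0 = visits_lim {} 0 J \<rho> z"
        using visits_lim_step[OF env, of z "{}" 0 J'] 1 J by (simp add: numeral_2_eq_2)
      \<comment> \<open>A cookie of strength at most \<open>3/4\<close> gives the factor
        \<open>7/8\<close>. One of the first \<open>e\<close> cookies may be stronger; it is paid
        for by the factor \<open>8/7\<close> released when \<open>e\<close> drops.\<close>
      also have "?E' * ((1 + ?p) / 2) \<le> ?E J K e"
      proof (cases e)
        case 0
        have "?E' * ((1 + ?p) / 2) \<le> ?E' * (7/8)"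
          using e[of 0] 0 1 E0 by (intro mult_left_mono) auto
        then show ?thesis using 0 K by simp
      next
        case (Suc e')
        have "?E' * ((1 + ?p) / 2) \<le> ?E' * 1" using p E0 by (intro mult_left_mono) auto
        then show ?thesis using Suc K by simp
      qed
      finally show ?thesis using 1 by simp
    next
      case 2
      let ?V = "visits_lim {} 0 J ?\<rho>"
      note IH = Suc.IH[OF cookie_env_consume[OF env, of z], of e]
      have e': "?\<rho> 1 i \<le> 3/4" if "e \<le> i" for i using e[OF that] 2 by (simp add: consume_other)
      have "visits {} 0 (Suc n) K (env_shift \<rho>) (Suc y)
          = ?p * visits {} 0 n K (env_shift ?\<rho>) z + (1 - ?p) * visits {} 0 n K (env_shift ?\<rho>) y"
        using 2 K by (simp add: env_shift_app env_shift_consume_Suc)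
      also have "\<dots> \<le> ?p * (?V (Suc z) + ?E J K e) + (1 - ?p) * (?V (Suc y) + ?E J K e)"
        using IH[OF e', of K "Suc z" J] IH[OF e', of K "Suc y" J] by (intro convex_comb_mono p) simp_all
      also have "\<dots> = (?p * ?V (Suc z) + (1 - ?p) * ?V (Suc y)) + ?E J K e" by (simp add: algebra_simps)
      also have "?p * ?V (Suc z) + (1 - ?p) * ?V (Suc y) = visits_lim {} 0 J \<rho> z"
        using visits_lim_step[OF env, of z "{}" 0 J'] 2 J by simp
      finally show ?thesis using 2 by simp
    qed
  qed
  \<comment> \<open>While the original walk stays at \<open>0\<close> the shifted walk does not move
    and \<open>n\<close> does not decrease. The induction runs over \<open>J\<close> instead, since
    every such stay is a visit to \<open>0\<close>.\<close>
  have zero: "visits {} 0 (Suc n) K (env_shift \<rho>) 0 \<le> visits_lim {} 0 J \<rho> 0 + ?E J K e / 2"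
    if "cookie_env \<rho>" "\<And>i. e \<le> i \<Longrightarrow> \<rho> 1 i \<le> 3/4" for \<rho> :: "nat \<Rightarrow> nat \<Rightarrow> real" and J K e
    using that
  proof (induction J arbitrary: \<rho>)
    case 0
    then show ?case using triv[OF 0(1), of 0 K 0 0 e] by simp
  next
    case (Suc J)
    let ?p = "\<rho> 0 0" and ?\<rho> = "consume \<rho> 0"
    let ?v = "visits {} 0 (Suc n) K (env_shift \<rho>) 0" and ?V = "visits_lim {} 0 J ?\<rho>"
    have env: "cookie_env ?\<rho>" by (rule cookie_env_consume) fact
    have e: "?\<rho> 1 i \<le> 3/4" if "e \<le> i" for i using Suc.prems(2)[OF that] by (simp add: consume_other)
    have p: "0 \<le> ?p" "?p \<le> 1" using cookie_envD[OF Suc.prems(1)] by auto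
    have "?v = ?p * ?v + (1 - ?p) * ?v" by (simp add: algebra_simps)
    also have "\<dots> \<le> ?p * (?V 1 + ?E J K e) + (1 - ?p) * (?V 0 + ?E J K e)"
    proof (intro convex_comb_mono p)
      show "?v \<le> ?V 1 + ?E J K e"
        using pos[where e = e and z = 1 and K = K and J = J, OF env e] by (simp add: env_shift_consume_0)
      have "?v \<le> ?V 0 + ?E J K e / 2" using Suc.IH[OF env e] by (simp add: env_shift_consume_0)
      then show "?v \<le> ?V 0 + ?E J K e" using E0[of J K e] by linarith
    qed
    also have "\<dots> = (?p * ?V 1 + (1 - ?p) * ?V 0) + ?E J K e" by (simp add: algebra_simps)
    also have "?p * ?V 1 + (1 - ?p) * ?V 0 = visits_lim {} 0 (Suc J) \<rho> 0"
      using visits_lim_step[OF Suc.prems(1), of 0 "{}" 0 J] by simp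
    finally show ?case by simp
  qed
  show ?case
    using pos[where e = e and z = z and K = K and J = J, OF Suc.prems]
      zero[where e = e and K = K and J = J, OF Suc.prems] by (cases "z = 0") auto
qed

lemma inf_visits_shift_le:
  fixes \<rho> :: "nat \<Rightarrow> nat \<Rightarrow> real"
  assumes "cookie_env \<rho>" "\<And>i. e \<le> i \<Longrightarrow> \<rho> 1 i \<le> 3/4"
  shows "inf_visits 0 (env_shift \<rho>) (z - 1) \<le> inf_visits 0 \<rho> z"
proof (rule LIMSEQ_le_const[OF inf_visits_tendsto[OF assms(1)]])
  note env' = cookie_env_shift[OF assms(1)]
  have "inf_visits 0 (env_shift \<rho>) (z - 1) \<le> visits_lim {} 0 J \<rho> z" for J
  proof (rule LIMSEQ_le_const)
    let ?f = "\<lambda>K. visits_lim {} 0 J \<rho> z + 2 ^ J * (7/8) ^ K * ((8/7) ^ e * (if z = 0 then 1/2 else 1))"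
    have "(\<lambda>K. (7/8::real) ^ K) \<longlonglongrightarrow> 0" by (rule LIMSEQ_realpow_zero) auto
    from tendsto_add[OF tendsto_const tendsto_mult[OF tendsto_mult[OF tendsto_const this] tendsto_const]]
    have "?f \<longlonglongrightarrow> visits_lim {} 0 J \<rho> z + 2 ^ J * 0 * ((8/7) ^ e * (if z = 0 then 1/2 else 1))" .
    then show "?f \<longlonglongrightarrow> visits_lim {} 0 J \<rho> z" by simp
    have "inf_visits 0 (env_shift \<rho>) (z - 1) \<le> ?f K" for K
    proof -
      have "visits {} 0 n K (env_shift \<rho>) (z - 1) \<le> ?f K" for n
        using visits_shift_le[where e = e and \<rho> = \<rho>, OF assms, of n K z J] by (simp only: mult.assoc)
      then have "visits_lim {} 0 K (env_shift \<rho>) (z - 1) \<le> ?f K" by (rule visits_lim_leI[OF env'])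
      with inf_visits_le_lim[OF env', of 0 "z - 1" K] show ?thesis by linarith
    qed
    then show "\<exists>N. \<forall>K\<ge>N. inf_visits 0 (env_shift \<rho>) (z - 1) \<le> ?f K" by blast
  qed
  then show "\<exists>N. \<forall>J\<ge>N. inf_visits 0 (env_shift \<rho>) (z - 1) \<le> visits_lim {} 0 J \<rho> z" by blast
qed

text \<open>\<open>omega_recurrent\<close> quantifies over all starting points. A start at
  \<open>z > 0\<close> is compared with the start \<open>z - 1\<close> in the shifted environment,
  until the start is the origin of some shift; the bound \<open>3/4\<close> is what
  \<open>inf_visits_shift_le\<close> asks for.\<close>

lemma inf_visits_eq_1:
  fixes \<rho> :: "nat \<Rightarrow> nat \<Rightarrow> real"
  assumes "cookie_env \<rho>" "\<And>m. inf_visits 0 ((env_shift ^^ m) \<rho>) 0 = 1" "\<And>m. \<exists>e. \<forall>i\<ge>e. \<rho> m i \<le> 3/4"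
  shows "inf_visits 0 \<rho> z = 1"
  using assms
proof (induction z arbitrary: \<rho>)
  case 0
  then show ?case using "0.prems"(2)[of 0] by simp
next
  case (Suc z)
  obtain e where e: "\<And>i. e \<le> i \<Longrightarrow> \<rho> 1 i \<le> 3/4" using Suc.prems(3)[of 1] by blast
  have "inf_visits 0 ((env_shift ^^ m) (env_shift \<rho>)) 0 = 1" for m
    using Suc.prems(2)[of "Suc m"] by (simp add: funpow_swap1)
  moreover have "\<exists>e. \<forall>i\<ge>e. env_shift \<rho> m i \<le> 3/4" for m
    using Suc.prems(3)[of "Suc m"] by (simp add: env_shift_app)
  ultimately have "inf_visits 0 (env_shift \<rho>) z = 1"
    by (intro Suc.IH cookie_env_shift Suc.prems(1))
  then show ?case
    using inf_visits_shift_le[where e = e and z = "Suc z", OF Suc.prems(1) e] inf_visits_le_1[OF Suc.prems(1), of 0 "Suc z"] by simp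
qed

text \<open>If the walk on \<open>[2, \<infinity>)\<close> makes fewer than \<open>J\<close> visits to \<open>2\<close> with positive probability, then so
  does a walk that in addition never steps from \<open>1\<close> to \<open>0\<close>: this costs a factor \<open>1/2\<close> per visit.\<close>
lemma escape_ge:
  fixes \<rho> :: "nat \<Rightarrow> nat \<Rightarrow> real"
  assumes "cookie_env \<rho>"
  shows "(1 - visits_lim {} 0 J (env_shift (env_shift \<rho>)) (y - 1)) * ((1/2) ^ J * (if y = 0 then 1/2 else 1))
    \<le> 1 - visits {} 0 n 1 \<rho> (Suc y)"
  using assms
proof (induction n arbitrary: J \<rho> y)
  case 0
  have "visits_lim {} 0 J (env_shift (env_shift \<rho>)) (y - 1) \<in> {0..1}"
    using 0 by (auto intro!: visits_lim_nonneg visits_lim_le_1 cookie_env_shift)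
  moreover have "(1/2) ^ J * (if y = 0 then 1/2 else 1) \<in> {0..1::real}"
    using power_le_one[of "1/2::real" J] by auto
  ultimately show ?case by (auto simp: mult_le_one)
next
  case (Suc n)
  note env = \<open>cookie_env \<rho>\<close>
  show ?case
  proof (cases J)
    case 0
    then show ?thesis using visits_le_1[OF env, of "{}" 0 "Suc n" 1 "Suc y"] by simp
  next
    case J: (Suc I)
    let ?p = "\<rho> (Suc y) 0" and ?\<rho> = "consume \<rho> (Suc y)"
    let ?v = "visits {} 0 n 1 ?\<rho>" and ?\<sigma> = "env_shift (env_shift \<rho>)"
    let ?w = "\<lambda>J y. 1 - visits_lim {} 0 J (env_shift (env_shift ?\<rho>)) y"
    have p: "1/2 \<le> ?p" "0 \<le> ?p" "?p \<le> 1" using cookie_envD[OF env] by auto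
    have env'': "cookie_env (env_shift (env_shift ?\<rho>))" by (intro cookie_env_shift cookie_env_consume env)
    have w0: "0 \<le> ?w J y" for J y using visits_lim_le_1[OF env''] by simp
    note IH = Suc.IH[OF cookie_env_consume[OF env, of "Suc y"]]
    have v: "1 - visits {} 0 (Suc n) 1 \<rho> (Suc y) = ?p * (1 - ?v (Suc (Suc y))) + (1 - ?p) * (1 - ?v y)"
      by (simp add: algebra_simps)
    have v1: "0 \<le> 1 - ?v y" using visits_le_1[OF cookie_env_consume[OF env]] by simp
    consider "y = 0" | "y = 1" | x where "y = Suc (Suc x)" by (metis One_nat_def old.nat.exhaust)
    then show ?thesis
    proof cases
      case 1
      \<comment> \<open>At site \<open>1\<close> only the jump to the right is kept. Its probability
        is at least \<open>1/2\<close>, which is the extra weight for \<open>y = 0\<close>.\<close>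
      have "(1/2) * (?w J 0 * (1/2) ^ J) \<le> ?p * (1 - ?v (Suc (Suc y)))"
        using IH[of J 1] 1 p w0 by (intro mult_mono) simp_all
      also have "\<dots> \<le> ?p * (1 - ?v (Suc (Suc y))) + (1 - ?p) * (1 - ?v y)" using v1 p by simp
      finally show ?thesis unfolding v using 1 by (simp add: env_shift_consume_0 env_shift_consume_Suc mult_ac)
    next
      case 2
      \<comment> \<open>Site \<open>2\<close> is the origin of the twice shifted environment. The
        visit lowers \<open>J\<close> to \<open>I\<close>, and the factor \<open>1/2\<close> so
        released covers the possible jump to site \<open>1\<close>.\<close>
      have split: "(p * a + (1 - p) * b) * (1/2) ^ Suc I = p * (a * (1/2) ^ I / 2) + (1 - p) * (b * (1/2) ^ I / 2)"
        for p a b :: real by (simp add: field_simps)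
      have eq: "1 - visits_lim {} 0 J ?\<sigma> 0 = ?p * ?w I 1 + (1 - ?p) * ?w I 0"
        using visits_lim_step[of ?\<sigma> 0 "{}" 0 I] cookie_env_shift[OF cookie_env_shift[OF env]] 2 J
        by (simp add: env_shift_app env_shift_consume_Suc algebra_simps numeral_2_eq_2)
      have "(1 - visits_lim {} 0 J ?\<sigma> 0) * (1/2) ^ J
         = ?p * (?w I 1 * (1/2) ^ I / 2) + (1 - ?p) * (?w I 0 * (1/2) ^ I / 2)"
        unfolding eq unfolding J by (rule split)
      also have "\<dots> \<le> ?p * (1 - ?v (Suc (Suc y))) + (1 - ?p) * (1 - ?v y)"
      proof (intro convex_comb_mono p)
        have "0 \<le> ?w I 1 * (1/2) ^ I" using w0[of I 1] by (intro mult_nonneg_nonneg) auto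
        moreover have "?w I 1 * (1/2) ^ I \<le> 1 - ?v (Suc (Suc y))" using IH[of I 2] 2 by (simp add: numeral_2_eq_2)
        ultimately show "?w I 1 * (1/2) ^ I / 2 \<le> 1 - ?v (Suc (Suc y))" by linarith
        show "?w I 0 * (1/2) ^ I / 2 \<le> 1 - ?v y" using IH[of I 0] 2 by simp
      qed
      finally show ?thesis unfolding v using 2 by simp
    next
      case 3
      have eq: "1 - visits_lim {} 0 J ?\<sigma> (Suc x) = ?p * ?w J y + (1 - ?p) * ?w J x"
        using visits_lim_step[of ?\<sigma> "Suc x" "{}" 0 I] cookie_env_shift[OF cookie_env_shift[OF env]] 3 J
        by (simp add: env_shift_app env_shift_consume_Suc algebra_simps)
      have "(1 - visits_lim {} 0 J ?\<sigma> (Suc x)) * (1/2) ^ J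
         = ?p * (?w J y * (1/2) ^ J) + (1 - ?p) * (?w J x * (1/2) ^ J)"
        unfolding eq by (simp add: algebra_simps)
      also have "\<dots> \<le> ?p * (1 - ?v (Suc (Suc y))) + (1 - ?p) * (1 - ?v y)"
        using IH[of J "Suc y"] IH[of J "Suc x"] 3 by (intro convex_comb_mono p) simp_all
      finally show ?thesis unfolding v using 3 by simp
    qed
  qed
qed

text \<open>The first cookie leads from \<open>0\<close> to \<open>1\<close> with probability at
  least \<open>1/2\<close>, and from there \<open>escape_ge\<close> gives a positive probability
  never to return, so a second visit to \<open>0\<close> is not certain.\<close>

lemma visits_lim_2_less_1:
  fixes \<rho> :: "nat \<Rightarrow> nat \<Rightarrow> real"
  assumes "cookie_env \<rho>" "inf_visits 0 ((env_shift ^^ 2) \<rho>) 0 < 1"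
  shows "visits_lim {} 0 2 \<rho> 0 < 1"
proof -
  let ?\<rho> = "consume \<rho> 0" and ?p = "\<rho> 0 0"
  let ?V = "\<lambda>J. visits_lim {} 0 J (env_shift (env_shift \<rho>)) 0"
  have env: "cookie_env ?\<rho>" by (rule cookie_env_consume) fact
  have "eventually (\<lambda>J. ?V J < 1) sequentially"
    using order_tendstoD(2)[OF inf_visits_tendsto[OF cookie_env_shift[OF cookie_env_shift[OF assms(1)]]]] assms(2)
    by (simp add: numeral_2_eq_2)
  then obtain J where J: "?V J < 1" by (auto simp: eventually_sequentially)
  define c where "c = (1 - ?V J) * ((1/2) ^ J * (1/2))"
  have c: "0 < c" using J by (simp add: c_def)
  have "visits {} 0 n 1 ?\<rho> 1 \<le> 1 - c" for n
    using escape_ge[OF env, of J 0 n] by (simp add: c_def env_shift_consume_0)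
  then have V1: "visits_lim {} 0 1 ?\<rho> 1 \<le> 1 - c" by (rule visits_lim_leI[OF env])
  have p: "1/2 \<le> ?p" "0 \<le> ?p" "?p \<le> 1" using cookie_envD[OF assms(1)] by auto
  have "visits_lim {} 0 2 \<rho> 0 = ?p * visits_lim {} 0 1 ?\<rho> 1 + (1 - ?p) * visits_lim {} 0 1 ?\<rho> 0"
    using visits_lim_step[OF assms(1), of 0 "{}" 0 1] by (simp add: numeral_2_eq_2)
  also have "\<dots> \<le> ?p * (1 - c) + (1 - ?p) * 1"
    by (intro convex_comb_mono p V1 visits_lim_le_1 env)
  also have "\<dots> = 1 - ?p * c" by (simp add: algebra_simps)
  also have "\<dots> < 1" using p c by simp
  finally show ?thesis .
qed

section \<open>Measurability\<close>

definition cookie_stack_space :: "(nat \<Rightarrow> real) measure" where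
  "cookie_stack_space = (\<Pi>\<^sub>M i\<in>(UNIV::nat set). restrict_space borel {1/2..1::real})"

lemma env_space_eq: "env_space = (\<Pi>\<^sub>M x\<in>(UNIV::int set). cookie_stack_space)"
  by (simp add: env_space_def cookie_stack_space_def)

lemma env_space_nonneg_eq: "env_space_nonneg = (\<Pi>\<^sub>M x\<in>(UNIV::nat set). cookie_stack_space)"
  by (simp add: env_space_nonneg_def cookie_stack_space_def)

lemma measurable_site: "(\<lambda>\<rho>. \<rho> z) \<in> measurable env_space_nonneg cookie_stack_space"
  unfolding env_space_nonneg_eq by (rule measurable_component_singleton) simp

lemma measurable_cookie_stack: "(\<lambda>c. c i) \<in> borel_measurable cookie_stack_space"
proof -
  have "(\<lambda>c. c i) \<in> measurable cookie_stack_space (restrict_space borel {1/2..1::real})"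
    unfolding cookie_stack_space_def by (rule measurable_component_singleton) simp
  moreover have "(\<lambda>x. x) \<in> borel_measurable (restrict_space borel {1/2..1::real})"
    by (intro measurable_restrict_space1 measurable_ident[unfolded id_def])
  ultimately show ?thesis by (rule measurable_compose)
qed

lemma measurable_cookie: "(\<lambda>\<rho>. \<rho> z i) \<in> borel_measurable env_space_nonneg"
  by (rule measurable_compose[OF measurable_site measurable_cookie_stack])

lemma measurable_drop_cookie: "(\<lambda>c i. c (Suc i)) \<in> measurable cookie_stack_space cookie_stack_space"
  unfolding cookie_stack_space_def
proof (rule measurable_PiM_single')
  show "(\<lambda>c. c (Suc i)) \<in> measurable (\<Pi>\<^sub>M i\<in>(UNIV::nat set). restrict_space borel {1/2..1::real}) (restrict_space borel {1/2..1})" for i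
    by (rule measurable_component_singleton) simp
qed (simp add: space_PiM PiE_def Pi_def)

lemma space_cookie_stack: "\<rho> \<in> space env_space_nonneg \<Longrightarrow> \<rho> z \<in> space cookie_stack_space"
  using measurable_space[OF measurable_site] by blast

lemma measurable_consume: "(\<lambda>\<rho>. consume \<rho> z) \<in> measurable env_space_nonneg env_space_nonneg"
proof -
  have "(\<lambda>\<rho>. consume \<rho> z y) \<in> measurable env_space_nonneg cookie_stack_space" for y
    using measurable_site[of y] measurable_compose[OF measurable_site measurable_drop_cookie, of z]
    by (cases "y = z") (simp_all add: consume_def)
  moreover from this have "(\<lambda>\<rho>. consume \<rho> z) \<in> space env_space_nonneg \<rightarrow> (\<Pi>\<^sub>E x\<in>UNIV. space cookie_stack_space)"
    by (auto dest: measurable_space)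
  ultimately show ?thesis
    by (subst (2) env_space_nonneg_eq) (rule measurable_PiM_single')
qed

lemma measurable_env_shift [measurable]: "env_shift \<in> measurable env_space_nonneg env_space_nonneg"
  by (subst (2) env_space_nonneg_eq, unfold env_shift_def)
     (rule measurable_PiM_single', auto intro: measurable_site space_cookie_stack)

lemma measurable_restrict_nonneg: "(\<lambda>\<omega> x. \<omega> (int x)) \<in> measurable env_space env_space_nonneg"
  unfolding env_space_eq env_space_nonneg_eq
proof (rule measurable_PiM_single')
  show "(\<lambda>\<omega>. \<omega> (int x)) \<in> measurable (\<Pi>\<^sub>M x\<in>(UNIV::int set). cookie_stack_space) cookie_stack_space" for x
    by (rule measurable_component_singleton) simp
qed (simp add: space_PiM PiE_def Pi_def)

lemma measurable_visits: "(\<lambda>\<rho>. visits S x n J \<rho> z) \<in> borel_measurable env_space_nonneg"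
proof (induction n arbitrary: J z)
  case 0
  show ?case by (cases J) simp_all
next
  case (Suc n)
  show ?case
  proof (cases J)
    case J: (Suc I)
    have IH: "(\<lambda>\<rho>. visits S x n K (consume \<rho> z) y) \<in> borel_measurable env_space_nonneg" for K y
      by (rule measurable_compose[OF measurable_consume Suc])
    show ?thesis
    proof (cases "z \<in> S")
      case True
      then have "(\<lambda>\<rho>. visits S x (Suc n) J \<rho> z) = (\<lambda>_. 0)" using J by auto
      then show ?thesis by simp
    next
      case False
      let ?K = "if z = x then I else J"
      have "(\<lambda>\<rho>. visits S x (Suc n) J \<rho> z) = (\<lambda>\<rho>. \<rho> z 0 * visits S x n ?K (consume \<rho> z) (z + 1)
          + (1 - \<rho> z 0) * visits S x n ?K (consume \<rho> z) (z - 1))"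
        using False J by simp
      also have "\<dots> \<in> borel_measurable env_space_nonneg"
        by (intro borel_measurable_add borel_measurable_times borel_measurable_diff borel_measurable_const
            measurable_cookie IH)
      finally show ?thesis .
    qed
  qed simp
qed

lemma measurable_visits_lim [measurable]: "(\<lambda>\<rho>. visits_lim S x J \<rho> z) \<in> borel_measurable env_space_nonneg"
  by (rule borel_measurable_LIMSEQ_real[OF visits_lim_tendsto measurable_visits])
     (simp only: cookie_env_space_nonneg)

lemma measurable_inf_visits [measurable]: "(\<lambda>\<rho>. inf_visits x \<rho> z) \<in> borel_measurable env_space_nonneg"
  by (rule borel_measurable_LIMSEQ_real[OF inf_visits_tendsto measurable_visits_lim])
     (simp only: cookie_env_space_nonneg)

lemma measurable_expected_drift [measurable]: "expected_drift S \<in> borel_measurable env_space_nonneg"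
proof -
  have "(\<lambda>\<rho>. (2 * \<rho> 0 i - 1) * visits_lim S 0 (Suc i) \<rho> 0) \<in> borel_measurable env_space_nonneg" for i
    by (intro borel_measurable_times borel_measurable_diff borel_measurable_const measurable_cookie measurable_visits_lim)
  then show ?thesis unfolding expected_drift_def by measurable
qed

lemma expected_drift_antimono:
  assumes "cookie_env \<rho>" "S \<subseteq> S'"
  shows "expected_drift S' \<rho> \<le> expected_drift S \<rho>"
  unfolding expected_drift_def using cookie_envD(1)[OF assms(1), of 0]
  by (intro suminf_le ennreal_leI mult_left_mono visits_lim_antimono_stop assms) (auto simp: field_simps)

lemma visits_far_stop: "z + n < M \<Longrightarrow> visits {M..} 0 n J \<rho> z = visits {} 0 n J \<rho> (z :: nat)"
  by (induction n arbitrary: J \<rho> z; case_tac J) auto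

text \<open>From \<open>z\<close>, \<open>M - Suc z\<close> steps stay below \<open>M\<close>, so
  the stopped probability lies between the unstopped one at that horizon and its limit.\<close>

lemma visits_lim_far_stop_tendsto:
  assumes "cookie_env \<rho>"
  shows "(\<lambda>M. visits_lim {M..} 0 J \<rho> (z::nat)) \<longlonglongrightarrow> visits_lim {} 0 J \<rho> z"
proof (rule tendsto_sandwich)
  show "(\<lambda>M. visits {} 0 (M - Suc z) J \<rho> z) \<longlonglongrightarrow> visits_lim {} 0 J \<rho> z"
  proof (rule LIMSEQ_offset[of _ "Suc z"])
    show "(\<lambda>n. visits {} 0 (n + Suc z - Suc z) J \<rho> z) \<longlonglongrightarrow> visits_lim {} 0 J \<rho> z"
      using visits_lim_tendsto[OF assms] by simp
  qed
  show "\<forall>\<^sub>F M in sequentially. visits {} 0 (M - Suc z) J \<rho> z \<le> visits_lim {M..} 0 J \<rho> z"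
    using eventually_gt_at_top[of z]
  proof eventually_elim
    case (elim M)
    then show ?case
      using visits_le_lim[OF assms, of "{M..}" 0 "M - Suc z" J z] visits_far_stop[of z "M - Suc z" M J \<rho>] by simp
  qed
  show "\<forall>\<^sub>F M in sequentially. visits_lim {M..} 0 J \<rho> z \<le> visits_lim {} 0 J \<rho> z"
    by (intro always_eventually allI visits_lim_antimono_stop assms) simp
qed simp

lemma expected_drift_SUP:
  assumes "cookie_env \<rho>"
  shows "(SUP M. expected_drift {M::nat..} \<rho>) = expected_drift {} \<rho>"
proof -
  let ?f = "\<lambda>M i. ennreal ((2 * \<rho> 0 i - 1) * visits_lim {M::nat..} 0 (Suc i) \<rho> 0)"
  have inc: "incseq (\<lambda>M. ?f M i)" for i
    using cookie_envD(1)[OF assms, of 0 i]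
    by (intro incseq_SucI ennreal_leI mult_left_mono visits_lim_antimono_stop assms) auto
  have "(SUP M. ?f M i) = ennreal ((2 * \<rho> 0 i - 1) * visits_lim {} 0 (Suc i) \<rho> 0)" for i
    by (rule LIMSEQ_unique[OF LIMSEQ_SUP[OF inc]])
       (intro tendsto_ennrealI tendsto_mult_left visits_lim_far_stop_tendsto assms)
  then show ?thesis
    unfolding expected_drift_def by (subst ennreal_suminf_SUP_eq[symmetric, OF inc]) simp
qed

section \<open>Stationary ergodic environments\<close>

locale stationary_cookies =
  fixes P :: "env measure"
  assumes prob: "prob_space P"
    and sets_P: "sets P = sets env_space"
    and stat: "stationary_ergodic P"
begin

abbreviation "Q \<equiv> nonneg_law P"

lemma restrict_measurable: "(\<lambda>\<omega> x. \<omega> (int x)) \<in> measurable P env_space_nonneg"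
  using measurable_restrict_nonneg measurable_cong_sets[OF sets_P refl] by blast

lemma sets_Q [measurable_cong]: "sets Q = sets env_space_nonneg"
  by (simp add: nonneg_law_def)

lemma space_Q: "space Q = space env_space_nonneg"
  by (simp add: nonneg_law_def)

lemma cookie_env_Q: "\<rho> \<in> space Q \<longleftrightarrow> cookie_env \<rho>"
  by (simp add: space_Q cookie_env_space_nonneg)

lemma cookie_env_P: "\<omega> \<in> space P \<Longrightarrow> cookie_env \<omega>"
  using cookie_env_space sets_eq_imp_space_eq[OF sets_P] by simp

lemma prob_Q: "prob_space Q"
  unfolding nonneg_law_def by (rule prob_space.prob_space_distr[OF prob restrict_measurable])

lemma measurable_shift_pow: "(env_shift ^^ m) \<in> measurable env_space_nonneg env_space_nonneg"
  by (induction m) (auto intro: measurable_comp measurable_env_shift)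

lemma measurable_shift_pow_Q: "(env_shift ^^ m) \<in> measurable Q env_space_nonneg"
  using measurable_shift_pow measurable_cong_sets[OF sets_Q refl] by blast

lemma distr_shift_pow: "distr Q env_space_nonneg (env_shift ^^ m) = Q"
proof (induction m)
  case 0
  have "distr Q env_space_nonneg (\<lambda>x. x) = distr Q Q (\<lambda>x. x)" by (rule distr_cong) (auto simp: sets_Q)
  then show ?case by (simp add: id_def)
next
  case (Suc m)
  have "distr Q env_space_nonneg (env_shift ^^ Suc m) = distr (distr Q env_space_nonneg (env_shift ^^ m)) env_space_nonneg env_shift"
    by (subst distr_distr[OF measurable_env_shift measurable_shift_pow_Q]) (simp add: comp_def)
  also have "\<dots> = Q" using stat by (simp add: Suc stationary_ergodic_def)
  finally show ?case .
qed

lemma AE_shift_pow: "(AE \<rho> in Q. p \<rho>) \<Longrightarrow> AE \<rho> in Q. p ((env_shift ^^ m) \<rho>)"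
  by (rule AE_distrD[OF measurable_shift_pow_Q]) (simp only: distr_shift_pow)

lemma AE_restrict: "(AE \<rho> in Q. p \<rho>) \<Longrightarrow> AE \<omega> in P. p (\<lambda>x. \<omega> (int x))"
  by (rule AE_distrD[OF restrict_measurable]) (simp only: nonneg_law_def)

lemma env_from_eq: "env_from (int x) \<omega> = (env_shift ^^ x) (\<lambda>j. \<omega> (int j))"
  by (simp add: env_from_def env_shift_pow)

lemma nn_integral_env_from:
  assumes "f \<in> borel_measurable env_space_nonneg"
  shows "(\<integral>\<^sup>+ \<omega>. f (env_from (int x) \<omega>) \<partial>P) = (\<integral>\<^sup>+ \<rho>. f \<rho> \<partial>Q)"
proof -
  have "(\<integral>\<^sup>+ \<rho>. f \<rho> \<partial>Q) = (\<integral>\<^sup>+ \<rho>. f \<rho> \<partial>distr Q env_space_nonneg (env_shift ^^ x))"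
    by (simp only: distr_shift_pow)
  also have "\<dots> = (\<integral>\<^sup>+ \<rho>. f ((env_shift ^^ x) \<rho>) \<partial>Q)"
    by (rule nn_integral_distr[OF measurable_shift_pow_Q]) (simp only: measurable_distr_eq1 assms)
  also have "\<dots> = (\<integral>\<^sup>+ \<omega>. f (env_from (int x) \<omega>) \<partial>P)"
    unfolding nonneg_law_def env_from_eq
    by (rule nn_integral_distr[OF restrict_measurable])
       (simp only: measurable_distr_eq1 measurable_compose[OF measurable_shift_pow assms])
  finally show ?thesis by simp
qed

lemma measurable_env_from:
  assumes "f \<in> borel_measurable env_space_nonneg"
  shows "(\<lambda>\<omega>. f (env_from (int x) \<omega>)) \<in> borel_measurable P"
  unfolding env_from_eq
  by (rule measurable_compose[OF restrict_measurable measurable_compose[OF measurable_shift_pow assms]])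

section \<open>The annealed drift at a site\<close>

definition drift :: "nat set \<Rightarrow> ennreal" where
  "drift S = (\<integral>\<^sup>+ \<rho>. expected_drift S \<rho> \<partial>Q)"

definition cookie_sum :: "(nat \<Rightarrow> nat \<Rightarrow> real) \<Rightarrow> ennreal" where
  "cookie_sum \<rho> = (\<Sum>i. ennreal (2 * \<rho> 0 i - 1))"

lemma measurable_cookie_sum [measurable]: "cookie_sum \<in> borel_measurable env_space_nonneg"
proof -
  have "(\<lambda>\<rho>. 2 * \<rho> 0 i - 1) \<in> borel_measurable env_space_nonneg" for i
    by (intro borel_measurable_times borel_measurable_diff borel_measurable_const measurable_cookie)
  then show ?thesis unfolding cookie_sum_def by measurable
qed

lemma nn_integral_delta: "(\<integral>\<^sup>+ \<omega>. delta \<omega> 0 \<partial>P) = (\<integral>\<^sup>+ \<rho>. cookie_sum \<rho> \<partial>Q)"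
  using nn_integral_env_from[OF measurable_cookie_sum, of 0]
  by (simp add: delta_def cookie_sum_def env_from_def)

text \<open>The walk from \<open>0\<close> visits \<open>x\<close> as the reflected walk visits the
  origin of the environment seen from \<open>x\<close>, and by stationarity the law of that
  environment does not depend on \<open>x\<close>. So \<open>drift {}\<close> describes all sites at
  once.\<close>

lemma annealed_drift:
  assumes "0 \<le> x"
  shows "annealed_E P 0 (\<lambda>\<omega> X. drift_inf \<omega> x X) = drift {}"
proof -
  have "annealed_E P 0 (\<lambda>\<omega> X. drift_inf \<omega> x X) = (\<integral>\<^sup>+ \<omega>. expected_drift {} (env_from (int (nat x)) \<omega>) \<partial>P)"
    unfolding annealed_E_def
  proof (rule nn_integral_cong)
    fix \<omega> assume "\<omega> \<in> space P"
    then have env: "cookie_env \<omega>" by (rule cookie_env_P)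
    have "visits_lim {} x J \<omega> 0 = visits_lim {} 0 J (env_from x \<omega>) (nat (0 - x))" for J
      by (rule visits_lim_reflected[OF env]) auto
    then show "(\<integral>\<^sup>+ X. drift_inf \<omega> x X \<partial>quenched \<omega> 0) = expected_drift {} (env_from (int (nat x)) \<omega>)"
      using assms by (simp add: nn_integral_drift_inf[OF env] expected_drift_def env_from_def)
  qed
  also have "\<dots> = drift {}" unfolding drift_def by (rule nn_integral_env_from) measurable
  finally show ?thesis .
qed

lemma drift_antimono: "S \<subseteq> S' \<Longrightarrow> drift S' \<le> drift S"
  unfolding drift_def by (intro nn_integral_mono expected_drift_antimono) (simp_all add: cookie_env_Q)

lemma nn_integral_sum_expected_drift:
  "(\<integral>\<^sup>+ \<omega>. (\<Sum>x\<in>{1..<K}. expected_drift {K - x..} (env_from (int x) \<omega>)) \<partial>P) = (\<Sum>x\<in>{1..<K}. drift {K - x..})"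
proof -
  have "(\<lambda>\<omega>. expected_drift {K - x..} (env_from (int x) \<omega>)) \<in> borel_measurable P" for x
    by (intro measurable_env_from measurable_expected_drift)
  then have "(\<integral>\<^sup>+ \<omega>. (\<Sum>x\<in>{1..<K}. expected_drift {K - x..} (env_from (int x) \<omega>)) \<partial>P)
    = (\<Sum>x\<in>{1..<K}. \<integral>\<^sup>+ \<omega>. expected_drift {K - x..} (env_from (int x) \<omega>) \<partial>P)"
    by (rule nn_integral_sum)
  then show ?thesis
    by (simp only: nn_integral_env_from[OF measurable_expected_drift] drift_def)
qed

lemma sum_drift_le:
  assumes "0 < K" shows "(\<Sum>x\<in>{1..<K}. drift {K - x..}) \<le> of_nat K"
proof -
  interpret prob_space P by (rule prob)
  have "(\<Sum>x\<in>{1..<K}. drift {K - x..}) \<le> (\<integral>\<^sup>+ \<omega>. of_nat K \<partial>P)"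
    unfolding nn_integral_sum_expected_drift[symmetric]
    by (intro nn_integral_mono sum_expected_drift_le assms cookie_env_P)
  then show ?thesis by (simp add: emeasure_space_1)
qed

lemma le_sum_drift:
  assumes "0 < K"
  shows "of_nat K \<le> (\<Sum>x\<in>{1..<K}. drift {K - x..}) + (of_nat J + of_nat K * (\<integral>\<^sup>+ \<rho>. ennreal (visits_lim {} 0 J \<rho> 0) \<partial>Q))"
proof -
  interpret prob_space P by (rule prob)
  have m: "(\<lambda>\<rho>. ennreal (visits_lim {} (0::nat) J \<rho> 0)) \<in> borel_measurable env_space_nonneg"
    by (rule measurable_compose[OF measurable_visits_lim measurable_ennreal])
  have "of_nat K = (\<integral>\<^sup>+ \<omega>. of_nat K \<partial>P)" by (simp add: emeasure_space_1)
  also have "\<dots> \<le> (\<integral>\<^sup>+ \<omega>. (\<Sum>x\<in>{1..<K}. expected_drift {K - x..} (env_from (int x) \<omega>))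
    + (of_nat J + of_nat K * ennreal (visits_lim {} 0 J (env_from (int 0) \<omega>) 0)) \<partial>P)"
  proof (rule nn_integral_mono)
    fix \<omega> assume "\<omega> \<in> space P"
    then show "of_nat K \<le> (\<Sum>x\<in>{1..<K}. expected_drift {K - x..} (env_from (int x) \<omega>))
      + (of_nat J + of_nat K * ennreal (visits_lim {} 0 J (env_from (int 0) \<omega>) 0))"
      using le_sum_expected_drift[OF cookie_env_P assms, of \<omega> J] by (simp only: of_nat_0)
  qed
  also have "\<dots> = (\<integral>\<^sup>+ \<omega>. (\<Sum>x\<in>{1..<K}. expected_drift {K - x..} (env_from (int x) \<omega>)) \<partial>P)
    + (of_nat J + of_nat K * (\<integral>\<^sup>+ \<omega>. ennreal (visits_lim {} 0 J (env_from (int 0) \<omega>) 0) \<partial>P))"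
  proof -
    have 1: "(\<lambda>\<omega>. \<Sum>x\<in>{1..<K}. expected_drift {K - x..} (env_from (int x) \<omega>)) \<in> borel_measurable P"
      by (intro borel_measurable_sum measurable_env_from measurable_expected_drift)
    have 2: "(\<lambda>\<omega>. ennreal (visits_lim {} 0 J (env_from (int 0) \<omega>) 0)) \<in> borel_measurable P"
      by (rule measurable_env_from[OF m])
    have 3: "(\<lambda>\<omega>. of_nat K * ennreal (visits_lim {} 0 J (env_from (int 0) \<omega>) 0)) \<in> borel_measurable P"
      by (intro borel_measurable_times_ennreal borel_measurable_const 2)
    show ?thesis
      unfolding nn_integral_add[OF 1 borel_measurable_add[OF borel_measurable_const 3]]
        nn_integral_add[OF borel_measurable_const 3] nn_integral_cmult[OF 2]
      by (simp add: emeasure_space_1)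
  qed
  finally show ?thesis
    unfolding nn_integral_sum_expected_drift nn_integral_env_from[OF m] .
qed

text \<open>All but a bounded number of sites below level \<open>K\<close> are at distance at least
  \<open>M\<close> from it and so have expected drift at least \<open>drift {M..}\<close>, while the
  total is at most \<open>K\<close>. Averaging bounds \<open>drift {M..}\<close> by
  \<open>1\<close>; then \<open>M\<close> tends to infinity.\<close>

lemma drift_le_1: "drift {} \<le> 1"
proof -
  have le: "drift {M..} \<le> 1" for M
  proof (rule ccontr)
    assume "\<not> drift {M..} \<le> 1"
    then have gt: "1 < drift {M..}" by simp
    \<comment> \<open>The level is \<open>M + L + 1\<close>, from which the sites \<open>1\<close>
      to \<open>L\<close> keep distance at least \<open>M + 1\<close>.\<close>
    have L: "of_nat L * drift {M..} \<le> of_nat (M + L + 1)" for L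
    proof -
      have "of_nat L * drift {M..} = (\<Sum>x\<in>{1..<L+1}. drift {M..})" by simp
      also have "\<dots> \<le> (\<Sum>x\<in>{1..<L+1}. drift {M + L + 1 - x..})"
        by (intro sum_mono drift_antimono) auto
      also have "\<dots> \<le> (\<Sum>x\<in>{1..<M+L+1}. drift {M + L + 1 - x..})"
        by (intro sum_mono2) auto
      also have "\<dots> \<le> of_nat (M + L + 1)" by (rule sum_drift_le) simp
      finally show ?thesis .
    qed
    have fin: "drift {M..} < top" using L[of 1] by (auto simp: less_top[symmetric] top_unique)
    then obtain r where r: "drift {M..} = ennreal r" "0 \<le> r" by (cases "drift {M..}") auto
    have "1 < r" using gt r ennreal_less_iff[of 1 r] by simp
    then obtain L :: nat where "real M + 1 < real L * (r - 1)"
      using ex_less_of_nat_mult[of "r - 1" "real M + 1"] by (metis diff_gt_0_iff_gt)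
    moreover have "real L * r \<le> real (M + L + 1)"
    proof -
      have "of_nat L * drift {M..} = ennreal (real L * r)"
        using r by (simp add: ennreal_of_nat_eq_real_of_nat ennreal_mult)
      then have "ennreal (real L * r) \<le> ennreal (real (M + L + 1))"
        using L[of L] by (simp only: ennreal_of_nat_eq_real_of_nat)
      then show ?thesis by (simp only: ennreal_le_iff of_nat_0_le_iff)
    qed
    ultimately show False by (simp add: algebra_simps)
  qed
  have "drift {} = (\<integral>\<^sup>+ \<rho>. (SUP M. expected_drift {M::nat..} \<rho>) \<partial>Q)"
    unfolding drift_def by (intro nn_integral_cong expected_drift_SUP[symmetric]) (simp add: cookie_env_Q)
  also have "\<dots> = (SUP M. drift {M::nat..})"
    unfolding drift_def
  proof (rule nn_integral_monotone_convergence_SUP_AE)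
    show "AE \<rho> in Q. expected_drift {M..} \<rho> \<le> expected_drift {Suc M..} \<rho>" for M :: nat
      by (intro AE_I2 expected_drift_antimono) (auto simp: cookie_env_Q)
  qed measurable
  also have "\<dots> \<le> 1" by (intro SUP_least le)
  finally show ?thesis .
qed

text \<open>The recurrence probability \<open>q\<close> grows along the shifts and its limit
  \<open>qbar\<close> is shift invariant, so \<open>qbar = 1\<close> has probability
  \<open>0\<close> or \<open>1\<close>. In the first case \<open>inf_visits_zero_one\<close> with
  \<open>c = qbar \<rho> < 1\<close> gives \<open>q = 0\<close>; in the second, stationarity gives
  \<open>q\<close> the same mean as \<open>qbar\<close>, namely \<open>1\<close>.\<close>

lemma zero_one: "(AE \<rho> in Q. inf_visits 0 \<rho> 0 = 0) \<or> (AE \<rho> in Q. inf_visits 0 \<rho> 0 = 1)"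
proof -
  interpret prob_space Q by (rule prob_Q)
  define q where "q \<rho> = inf_visits 0 \<rho> (0::nat)" for \<rho>
  define qbar where "qbar \<rho> = (SUP m. q ((env_shift ^^ m) \<rho>))" for \<rho>
  have q01: "0 \<le> q \<rho>" "q \<rho> \<le> 1" if "cookie_env \<rho>" for \<rho>
    unfolding q_def using that by (simp_all add: inf_visits_nonneg inf_visits_le_1)
  have inc: "incseq (\<lambda>m. q ((env_shift ^^ m) \<rho>))" if "cookie_env \<rho>" for \<rho>
    unfolding q_def using inf_visits_le_shift[OF cookie_env_shift_pow[OF that], of _ 0] by (intro incseq_SucI) simp
  have bdd: "bdd_above (range (\<lambda>m. q ((env_shift ^^ m) \<rho>)))" if "cookie_env \<rho>" for \<rho>
    using q01(2)[OF cookie_env_shift_pow[OF that]] by (intro bdd_aboveI[where M=1]) auto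
  have lim: "(\<lambda>m. q ((env_shift ^^ m) \<rho>)) \<longlonglongrightarrow> qbar \<rho>" if "cookie_env \<rho>" for \<rho>
    unfolding qbar_def by (rule LIMSEQ_incseq_SUP[OF bdd inc]) (fact that)+
  have q_le: "q ((env_shift ^^ m) \<rho>) \<le> qbar \<rho>" if "cookie_env \<rho>" for \<rho> m
    using incseq_le[OF inc lim] that by blast
  have qbar1: "qbar \<rho> \<le> 1" if "cookie_env \<rho>" for \<rho>
    by (rule LIMSEQ_le_const2[OF lim[OF that]]) (use q01(2)[OF cookie_env_shift_pow[OF that]] in blast)
  have q_meas: "q \<in> borel_measurable env_space_nonneg" unfolding q_def by (rule measurable_inf_visits)
  have q_meas_Q: "q \<in> borel_measurable Q" unfolding measurable_cong_sets[OF sets_Q refl] by (rule q_meas)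
  have q_pow: "(\<lambda>\<rho>. q ((env_shift ^^ m) \<rho>)) \<in> borel_measurable env_space_nonneg" for m
    by (rule measurable_compose[OF measurable_shift_pow q_meas])
  have qbar_meas: "qbar \<in> borel_measurable env_space_nonneg"
    by (rule borel_measurable_LIMSEQ_real[OF lim q_pow]) (simp only: cookie_env_space_nonneg)
  have qbar_meas_Q: "qbar \<in> borel_measurable Q" using qbar_meas measurable_cong_sets[OF sets_Q refl] by blast
  have qbar_shift: "qbar (env_shift \<rho>) = qbar \<rho>" if "cookie_env \<rho>" for \<rho>
  proof (rule LIMSEQ_unique[OF lim[OF cookie_env_shift[OF that]]])
    show "(\<lambda>m. q ((env_shift ^^ m) (env_shift \<rho>))) \<longlonglongrightarrow> qbar \<rho>"
      using LIMSEQ_Suc[OF lim[OF that]] by (simp add: funpow_swap1)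
  qed
  define A where "A = qbar -` {1} \<inter> space env_space_nonneg"
  have A: "A \<in> sets env_space_nonneg" unfolding A_def by (rule measurable_sets[OF qbar_meas]) simp
  have A_iff: "\<rho> \<in> A \<longleftrightarrow> cookie_env \<rho> \<and> qbar \<rho> = 1" for \<rho>
    unfolding A_def cookie_env_space_nonneg[symmetric] by blast
  \<comment> \<open>The definition of ergodicity asks for exactly invariant sets, not just almost
    surely invariant ones; \<open>qbar_shift\<close> holds for every cookie environment, so
    \<open>A\<close> qualifies.\<close>
  have "\<rho> \<in> env_shift -` A \<inter> space env_space_nonneg \<longleftrightarrow> \<rho> \<in> A" for \<rho>
    unfolding Int_iff vimage_eq A_iff cookie_env_space_nonneg
    using qbar_shift[of \<rho>] cookie_env_shift[of \<rho>] by metis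
  then have "env_shift -` A \<inter> space env_space_nonneg = A" by blast
  with stat A have "measure Q A = 0 \<or> measure Q A = 1"
    unfolding stationary_ergodic_def by blast
  then show ?thesis
  proof
    assume "measure Q A = 0"
    then have "AE \<rho> in Q. \<rho> \<notin> A" using A by (subst prob_eq_0[symmetric]) (simp_all only: sets_Q)
    then have "AE \<rho> in Q. q \<rho> = 0"
    proof (rule AE_mp, intro AE_I2 impI)
      fix \<rho> assume "\<rho> \<in> space Q" "\<rho> \<notin> A"
      then have env: "cookie_env \<rho>" and "qbar \<rho> \<noteq> 1" by (simp_all add: A_iff cookie_env_Q)
      then have "qbar \<rho> < 1" using qbar1[OF env] by simp
      moreover have "q \<rho> \<le> qbar \<rho> * q \<rho>"
        unfolding q_def by (rule inf_visits_zero_one[OF env]) (rule q_le[OF env, unfolded q_def])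
      ultimately show "q \<rho> = 0"
        using q01(1)[OF env] mult_le_cancel_right1[of "q \<rho>" "qbar \<rho>"] by linarith
    qed
    then show ?thesis by (simp add: q_def)
  next
    assume "measure Q A = 1"
    then have AE: "AE \<rho> in Q. qbar \<rho> = 1"
    proof -
      have "AE \<rho> in Q. \<rho> \<in> A" using A \<open>measure Q A = 1\<close> by (subst prob_eq_1[symmetric]) (simp_all only: sets_Q)
      then show ?thesis by (rule AE_mp) (simp add: A_iff)
    qed
    have "(\<lambda>m. \<integral>\<rho>. q ((env_shift ^^ m) \<rho>) \<partial>Q) \<longlonglongrightarrow> (\<integral>\<rho>. qbar \<rho> \<partial>Q)"
    proof (rule integral_dominated_convergence[where w = "\<lambda>_. 1"])
      show "AE \<rho> in Q. (\<lambda>m. q ((env_shift ^^ m) \<rho>)) \<longlonglongrightarrow> qbar \<rho>"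
        by (intro AE_I2 lim) (simp only: cookie_env_Q)
      show "AE \<rho> in Q. norm (q ((env_shift ^^ m) \<rho>)) \<le> 1" for m
      proof (rule AE_I2)
        fix \<rho> assume "\<rho> \<in> space Q"
        then have "cookie_env ((env_shift ^^ m) \<rho>)" by (intro cookie_env_shift_pow) (simp only: cookie_env_Q)
        then show "norm (q ((env_shift ^^ m) \<rho>)) \<le> 1" using q01 by (simp only: real_norm_def abs_of_nonneg)
      qed
      show "qbar \<in> borel_measurable Q" "(\<lambda>\<rho>. q ((env_shift ^^ m) \<rho>)) \<in> borel_measurable Q" for m
        by (rule qbar_meas_Q) (use q_pow measurable_cong_sets[OF sets_Q refl] in blast)
    qed simp
    moreover have "(\<integral>\<rho>. q ((env_shift ^^ m) \<rho>) \<partial>Q) = (\<integral>\<rho>. q \<rho> \<partial>Q)" for m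
      using integral_distr[OF measurable_shift_pow_Q q_meas, of m] by (simp only: distr_shift_pow)
    ultimately have "(\<lambda>m::nat. \<integral>\<rho>. q \<rho> \<partial>Q) \<longlonglongrightarrow> (\<integral>\<rho>. qbar \<rho> \<partial>Q)" by (simp only:)
    then have "(\<integral>\<rho>. q \<rho> \<partial>Q) = (\<integral>\<rho>. qbar \<rho> \<partial>Q)" by (rule LIMSEQ_unique[OF tendsto_const])
    also have "\<dots> = (\<integral>\<rho>. 1 \<partial>Q)" by (intro integral_cong_AE qbar_meas_Q AE borel_measurable_const)
    finally have int1: "(\<integral>\<rho>. q \<rho> \<partial>Q) = 1" by (simp add: prob_space)
    have q_AE: "AE \<rho> in Q. 0 \<le> q \<rho> \<and> q \<rho> \<le> 1"
      by (rule AE_I2) (simp only: cookie_env_Q q01 simp_thms)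
    have int: "integrable Q q"
    proof (rule integrable_const_bound[OF _ q_meas_Q])
      show "AE \<rho> in Q. norm (q \<rho>) \<le> 1" using q_AE by (rule AE_mp) (rule AE_I2, auto)
    qed
    have "(\<integral>\<rho>. 1 - q \<rho> \<partial>Q) = 0"
      using int1 by (subst Bochner_Integration.integral_diff[OF _ int]) (simp_all add: prob_space)
    moreover have "integrable Q (\<lambda>\<rho>. 1 - q \<rho>)" by (intro Bochner_Integration.integrable_diff int) simp
    moreover have "AE \<rho> in Q. 0 \<le> 1 - q \<rho>" using q_AE by (rule AE_mp) (rule AE_I2, auto)
    ultimately have "AE \<rho> in Q. 1 - q \<rho> = 0" using integral_nonneg_eq_0_iff_AE by blast
    then have "AE \<rho> in Q. q \<rho> = 1" by (rule AE_mp) (rule AE_I2, auto)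
    then show ?thesis by (simp only: q_def simp_thms)
  qed
qed

lemma visits_lim_meas_Q: "(\<lambda>\<rho>. visits_lim S (x::nat) J \<rho> z) \<in> borel_measurable Q"
  using measurable_visits_lim measurable_cong_sets[OF sets_Q refl] by blast

text \<open>Dividing \<open>le_sum_drift\<close> by \<open>K\<close> and letting \<open>K\<close>
  tend to infinity gives \<open>1 \<le> drift {} + a J\<close>, where \<open>a J\<close> is the mean
  probability of at least \<open>J\<close> visits. For a transient walk \<open>a J\<close> tends to
  \<open>0\<close>.\<close>

lemma one_le_drift:
  assumes "AE \<rho> in Q. inf_visits 0 \<rho> 0 = 0"
  shows "1 \<le> drift {}"
proof -
  interpret prob_space Q by (rule prob_Q)
  define a where "a J = (\<integral>\<rho>. visits_lim {} 0 J \<rho> (0::nat) \<partial>Q)" for J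
  have v_AE: "AE \<rho> in Q. 0 \<le> visits_lim {} 0 J \<rho> (0::nat) \<and> visits_lim {} 0 J \<rho> (0::nat) \<le> 1" for J
    by (rule AE_I2) (simp add: cookie_env_Q visits_lim_nonneg visits_lim_le_1)
  have v_norm: "AE \<rho> in Q. norm (visits_lim {} 0 J \<rho> (0::nat)) \<le> 1" for J
    using v_AE[of J] by (rule AE_mp) (rule AE_I2, auto)
  have int: "integrable Q (\<lambda>\<rho>. visits_lim {} 0 J \<rho> (0::nat))" for J
    by (rule integrable_const_bound[OF v_norm visits_lim_meas_Q])
  have a0: "0 \<le> a J" for J
    unfolding a_def by (rule integral_nonneg_AE) (use v_AE[of J] in \<open>rule AE_mp\<close>, rule AE_I2, auto)
  have nn: "(\<integral>\<^sup>+ \<rho>. ennreal (visits_lim {} 0 J \<rho> (0::nat)) \<partial>Q) = ennreal (a J)" for J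
    unfolding a_def by (rule nn_integral_eq_integral[OF int]) (use v_AE[of J] in \<open>rule AE_mp\<close>, rule AE_I2, auto)
  have "(\<lambda>J. a J) \<longlonglongrightarrow> (\<integral>\<rho>. 0 \<partial>Q)"
    unfolding a_def
  proof (rule integral_dominated_convergence[where w = "\<lambda>_. 1"])
    show "AE \<rho> in Q. (\<lambda>J. visits_lim {} 0 J \<rho> (0::nat)) \<longlonglongrightarrow> 0"
      using assms
    proof (rule AE_mp, intro AE_I2 impI)
      fix \<rho> assume "\<rho> \<in> space Q" and q: "inf_visits 0 \<rho> (0::nat) = 0"
      then have "cookie_env \<rho>" by (simp only: cookie_env_Q)
      from inf_visits_tendsto[OF this, of 0 0] show "(\<lambda>J. visits_lim {} 0 J \<rho> (0::nat)) \<longlonglongrightarrow> 0"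
        by (simp only: q)
    qed
  qed (rule borel_measurable_const visits_lim_meas_Q v_norm integrable_const)+
  then have a_lim: "a \<longlonglongrightarrow> 0" by simp
  obtain r where r: "drift {} = ennreal r" "0 \<le> r" using drift_le_1 by (cases "drift {}") (auto simp: top_unique)
  have real: "K \<le> K * r + (J + K * a J)" if "0 < K" for K J :: nat
  proof -
    have "(\<Sum>x\<in>{1..<K}. drift {K - x..}) \<le> (\<Sum>x\<in>{1..<K}. drift {})"
      by (intro sum_mono drift_antimono) simp
    also have "\<dots> \<le> of_nat K * drift {}" by (auto intro!: mult_right_mono)
    also have "\<dots> = ennreal (K * r)" using r by (simp add: ennreal_of_nat_eq_real_of_nat ennreal_mult)
    finally have "of_nat K \<le> ennreal (K * r) + (of_nat J + of_nat K * ennreal (a J))"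
      using le_sum_drift[OF that, of J] unfolding nn by (meson add_right_mono order_trans)
    also have "\<dots> = ennreal (K * r + (J + K * a J))"
      using r a0[of J] by (simp add: ennreal_of_nat_eq_real_of_nat ennreal_mult ennreal_plus)
    finally have "ennreal (real K) \<le> ennreal (K * r + (J + K * a J))" by (simp only: ennreal_of_nat_eq_real_of_nat)
    moreover have "0 \<le> K * r + (J + K * a J)" using r a0[of J] by simp
    ultimately show ?thesis by (simp only: ennreal_le_iff)
  qed
  have "1 \<le> r + a J" for J
  proof (rule ccontr)
    assume "\<not> 1 \<le> r + a J"
    then obtain K :: nat where K: "real J < real K * (1 - r - a J)"
      using ex_less_of_nat_mult[of "1 - r - a J" "real J"] by auto
    then have "0 < K" by (cases K) auto
    from real[OF this, of J] K show False by (simp add: algebra_simps)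
  qed
  then have "1 \<le> r + 0"
    by (intro LIMSEQ_le_const[OF tendsto_add[OF tendsto_const a_lim]]) blast
  then show ?thesis using r by simp
qed

lemma drift_le_cookie_sum: "drift {} \<le> (\<integral>\<^sup>+ \<rho>. cookie_sum \<rho> \<partial>Q)"
  unfolding drift_def
proof (rule nn_integral_mono)
  fix \<rho> assume "\<rho> \<in> space Q"
  then have env: "cookie_env \<rho>" by (simp only: cookie_env_Q)
  have "(2 * \<rho> 0 i - 1) * visits_lim {} 0 (Suc i) \<rho> 0 \<le> (2 * \<rho> 0 i - 1) * 1" for i
    using cookie_envD(1)[OF env, of 0 i] by (intro mult_left_mono visits_lim_le_1 env) simp
  then show "expected_drift {} \<rho> \<le> cookie_sum \<rho>"
    unfolding expected_drift_def cookie_sum_def by (intro suminf_le ennreal_leI) simp_all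
qed

lemma drift_eq_cookie_sum:
  assumes "AE \<rho> in Q. inf_visits 0 \<rho> 0 = 1"
  shows "drift {} = (\<integral>\<^sup>+ \<rho>. cookie_sum \<rho> \<partial>Q)"
  unfolding drift_def
proof (rule nn_integral_cong_AE, use assms in \<open>rule AE_mp\<close>, intro AE_I2 impI)
  fix \<rho> assume "\<rho> \<in> space Q" and q: "inf_visits 0 \<rho> (0::nat) = 1"
  then have env: "cookie_env \<rho>" by (simp only: cookie_env_Q)
  have "visits_lim {} 0 J \<rho> 0 = 1" for J
    using inf_visits_le_lim[OF env, of 0 0 J] visits_lim_le_1[OF env, of "{}" 0 J 0] q by simp
  then show "expected_drift {} \<rho> = cookie_sum \<rho>"
    by (simp add: expected_drift_def cookie_sum_def)
qed

lemma drift_eq_min: "drift {} = min 1 (\<integral>\<^sup>+ \<rho>. cookie_sum \<rho> \<partial>Q)"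
  using zero_one
proof
  assume "AE \<rho> in Q. inf_visits 0 \<rho> 0 = 0"
  from one_le_drift[OF this] have "drift {} = 1" using drift_le_1 by simp
  then show ?thesis using drift_le_cookie_sum by (simp add: min_def)
next
  assume "AE \<rho> in Q. inf_visits 0 \<rho> 0 = 1"
  from drift_eq_cookie_sum[OF this] show ?thesis using drift_le_1 by (simp add: min_absorb2)
qed

section \<open>Recurrence of the walk in terms of the half-line environment\<close>

lemma omega_recurrent_iff:
  assumes "\<omega> \<in> space P"
  shows "omega_recurrent \<omega> x \<longleftrightarrow> (\<forall>z. inf_visits 0 (env_from x \<omega>) (nat (z - x)) = 1)"
proof -
  have env: "cookie_env \<omega>" by (rule cookie_env_P) fact
  have "visits_lim {} x J \<omega> z = visits_lim {} 0 J (env_from x \<omega>) (nat (z - x))" for z J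
    by (rule visits_lim_reflected[OF env]) auto
  then have "inf_visits x \<omega> z = inf_visits 0 (env_from x \<omega>) (nat (z - x))" for z
    by (simp only: inf_visits_def)
  then show ?thesis by (simp only: omega_recurrent_def measure_R_event[OF env])
qed

text \<open>Finite total drift makes \<open>2 * \<rho> 0 i - 1\<close> tend to \<open>0\<close>;
  once below \<open>1/2\<close>, it leaves a cookie of strength at most \<open>3/4\<close>.\<close>

lemma cookies_bounded_away:
  assumes "cookie_env \<rho>" "cookie_sum \<rho> \<noteq> \<infinity>"
  shows "\<exists>e. \<forall>i\<ge>e. \<rho> 0 i \<le> 3/4"
proof -
  have "summable (\<lambda>i. 2 * \<rho> 0 i - 1)"
    by (rule summable_suminf_not_top) (use assms cookie_envD(1)[OF assms(1), of 0] in \<open>auto simp: cookie_sum_def field_simps\<close>)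
  from order_tendstoD(2)[OF summable_LIMSEQ_zero[OF this], of "1/2"]
  obtain e where e: "\<And>i. e \<le> i \<Longrightarrow> 2 * \<rho> 0 i - 1 < 1/2" by (auto simp: eventually_sequentially)
  have "\<rho> 0 i \<le> 3/4" if "e \<le> i" for i using e[OF that] by simp
  then show ?thesis by blast
qed

text \<open>The first assumption only concerns starts at the origin. A finite mean makes the total
  drift finite at all sites almost surely, so the cookies are eventually at most \<open>3/4\<close>,
  as \<open>inf_visits_eq_1\<close> needs for arbitrary starts.\<close>

lemma walk_recurrentI:
  assumes "AE \<rho> in Q. inf_visits 0 \<rho> 0 = 1" "(\<integral>\<^sup>+ \<rho>. cookie_sum \<rho> \<partial>Q) \<le> 1"
  shows "walk_recurrent P"
  unfolding walk_recurrent_def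
proof (intro allI impI)
  fix x :: int assume x: "0 \<le> x"
  have "cookie_sum \<in> borel_measurable Q"
    using measurable_cookie_sum measurable_cong_sets[OF sets_Q refl] by blast
  moreover have "(\<integral>\<^sup>+ \<rho>. cookie_sum \<rho> \<partial>Q) \<noteq> \<infinity>" using assms(2) by (auto simp: top_unique)
  ultimately have "AE \<rho> in Q. cookie_sum \<rho> \<noteq> \<infinity>" by (rule nn_integral_PInf_AE)
  from AE_shift_pow[OF this] AE_shift_pow[OF assms(1)]
  have "AE \<rho> in Q. (\<forall>m. cookie_sum ((env_shift ^^ m) \<rho>) \<noteq> \<infinity>) \<and> (\<forall>m. inf_visits 0 ((env_shift ^^ m) \<rho>) 0 = 1)"
    unfolding AE_conj_iff AE_all_countable by blast
  from AE_restrict[OF this] show "AE \<omega> in P. omega_recurrent \<omega> x"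
  proof (rule AE_mp, intro AE_I2 impI)
    fix \<omega> :: env let ?\<rho> = "\<lambda>j. \<omega> (int j)"
    assume \<omega>: "\<omega> \<in> space P"
      and *: "(\<forall>m. cookie_sum ((env_shift ^^ m) ?\<rho>) \<noteq> \<infinity>) \<and> (\<forall>m. inf_visits 0 ((env_shift ^^ m) ?\<rho>) 0 = 1)"
    have env: "cookie_env ?\<rho>" using cookie_env_P[OF \<omega>] by (auto simp: cookie_env_def)
    have x': "env_from x \<omega> = (env_shift ^^ nat x) ?\<rho>" using env_from_eq[of "nat x" \<omega>] x by simp
    have pow: "(env_shift ^^ m) (env_from x \<omega>) = (env_shift ^^ (m + nat x)) ?\<rho>" for m
      unfolding x' by (simp only: funpow_add comp_def)
    have "\<exists>e. \<forall>i\<ge>e. env_from x \<omega> m i \<le> 3/4" for m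
    proof -
      have "\<exists>e. \<forall>i\<ge>e. ((env_shift ^^ (m + nat x)) ?\<rho>) 0 i \<le> 3/4"
        using * by (intro cookies_bounded_away cookie_env_shift_pow env) blast
      then show ?thesis by (simp only: pow[symmetric] env_shift_pow[of m] add_0_right)
    qed
    moreover have "inf_visits 0 ((env_shift ^^ m) (env_from x \<omega>)) 0 = 1" for m
      unfolding pow using * by blast
    ultimately show "omega_recurrent \<omega> x"
      unfolding omega_recurrent_iff[OF \<omega>] using inf_visits_eq_1 cookie_env_from cookie_env_P[OF \<omega>] by blast
  qed
qed

lemma walk_recurrentD:
  assumes "walk_recurrent P" shows "AE \<rho> in Q. inf_visits 0 \<rho> 0 = 1"
proof (rule ccontr)
  assume "\<not> ?thesis"
  with zero_one have "AE \<rho> in Q. inf_visits 0 \<rho> 0 = 0" by blast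
  from AE_restrict[OF this] have "AE \<omega> in P. inf_visits 0 (env_from 0 \<omega>) 0 = 0"
    using env_from_eq[of 0] by (simp add: id_def)
  moreover have "AE \<omega> in P. omega_recurrent \<omega> 0" using assms by (simp add: walk_recurrent_def)
  ultimately have "AE \<omega> in P. False"
  proof (rule AE_mp[OF AE_conjI], intro AE_I2 impI)
    fix \<omega> assume "\<omega> \<in> space P" and *: "inf_visits 0 (env_from 0 \<omega>) 0 = 0 \<and> omega_recurrent \<omega> 0"
    then have "inf_visits 0 (env_from 0 \<omega>) (nat (0 - 0)) = 1" using omega_recurrent_iff by blast
    with * show False by simp
  qed
  then show False using prob_space.AE_False[OF prob] by simp
qed

text \<open>The expression is the expected uneaten drift of the cookie with index \<open>i\<close>.
  Eaten and total drift have the same finite mean \<open>1\<close>, so this nonnegative defect has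
  mean \<open>0\<close>.\<close>

lemma nn_integral_defect_eq_0:
  assumes "drift {} = 1" "(\<integral>\<^sup>+ \<rho>. cookie_sum \<rho> \<partial>Q) = 1"
  shows "AE \<rho> in Q. (2 * \<rho> 0 i - 1) * (1 - visits_lim {} 0 (Suc i) \<rho> 0) = 0"
proof -
  let ?c = "\<lambda>\<rho>. (2 * \<rho> 0 i - 1) * (1 - visits_lim {} 0 (Suc i) \<rho> (0::nat))"
  have c_meas: "?c \<in> borel_measurable env_space_nonneg"
    by (intro borel_measurable_times borel_measurable_diff borel_measurable_const measurable_cookie measurable_visits_lim)
  then have c_meas_Q: "(\<lambda>\<rho>. ennreal (?c \<rho>)) \<in> borel_measurable Q"
    unfolding measurable_cong_sets[OF sets_Q refl] by (rule measurable_compose[OF _ measurable_ennreal])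
  have g_meas_Q: "expected_drift {} \<in> borel_measurable Q"
    unfolding measurable_cong_sets[OF sets_Q refl] by (rule measurable_expected_drift)
  have c0: "0 \<le> ?c \<rho>" if "cookie_env \<rho>" for \<rho>
    using cookie_envD(1)[OF that, of 0 i] visits_lim_le_1[OF that] by (intro mult_nonneg_nonneg) auto
  have "drift {} + (\<integral>\<^sup>+ \<rho>. ennreal (?c \<rho>) \<partial>Q) = (\<integral>\<^sup>+ \<rho>. expected_drift {} \<rho> + ennreal (?c \<rho>) \<partial>Q)"
    unfolding drift_def by (rule nn_integral_add[symmetric, OF g_meas_Q c_meas_Q])
  also have "\<dots> \<le> (\<integral>\<^sup>+ \<rho>. cookie_sum \<rho> \<partial>Q)"
  proof (rule nn_integral_mono)
    fix \<rho> assume "\<rho> \<in> space Q"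
    then have env: "cookie_env \<rho>" by (simp only: cookie_env_Q)
    let ?e = "\<lambda>j. if j = i then ennreal (?c \<rho>) else 0"
    let ?d = "\<lambda>j. 2 * \<rho> 0 j - 1" and ?v = "\<lambda>j. visits_lim {} 0 (Suc j) \<rho> (0::nat)"
    have e: "ennreal (?c \<rho>) = (\<Sum>j. ?e j)"
      by (subst suminf_finite[of "{i}"]) auto
    have "expected_drift {} \<rho> + ennreal (?c \<rho>) = (\<Sum>j. ennreal (?d j * ?v j)) + (\<Sum>j. ?e j)"
      unfolding e[symmetric] expected_drift_def by (rule refl)
    also have "\<dots> = (\<Sum>j. ennreal (?d j * ?v j) + ?e j)" by (rule suminf_add) simp_all
    also have "\<dots> \<le> cookie_sum \<rho>"
      unfolding cookie_sum_def
    proof (rule suminf_le)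
      fix j
      have d: "0 \<le> ?d j" using cookie_envD(1)[OF env, of 0 j] by simp
      show "ennreal (?d j * ?v j) + ?e j \<le> ennreal (?d j)"
      proof (cases "j = i")
        case True
        have "ennreal (?d j * ?v j) + ?e j = ennreal (?d j * ?v j + ?c \<rho>)"
          using True c0[OF env] drift_visits_nonneg[OF env, of 0 j "{}" 0 "Suc j" 0] by (simp add: ennreal_plus)
        also have "?d j * ?v j + ?c \<rho> = ?d j" using True by (simp add: algebra_simps)
        finally show ?thesis by simp
      next
        case False
        have "?d j * ?v j \<le> ?d j * 1" using d by (intro mult_left_mono visits_lim_le_1 env)
        then show ?thesis using False by (simp add: ennreal_leI)
      qed
    qed simp_all
    finally show "expected_drift {} \<rho> + ennreal (?c \<rho>) \<le> cookie_sum \<rho>" .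
  qed
  finally have "1 + (\<integral>\<^sup>+ \<rho>. ennreal (?c \<rho>) \<partial>Q) \<le> 1 + 0" by (simp only: assms add_0_right)
  then have "(\<integral>\<^sup>+ \<rho>. ennreal (?c \<rho>) \<partial>Q) = 0"
    by (subst (asm) ennreal_add_left_cancel_le) auto
  then have "AE \<rho> in Q. ennreal (?c \<rho>) = 0" by (rule nn_integral_0_iff_AE[OF c_meas_Q, THEN iffD1])
  then show ?thesis
  proof (rule AE_mp, intro AE_I2 impI)
    fix \<rho> assume "\<rho> \<in> space Q" "ennreal (?c \<rho>) = 0"
    moreover from this have "0 \<le> ?c \<rho>" by (intro c0) (simp only: cookie_env_Q)
    ultimately show "?c \<rho> = 0" by (simp only: ennreal_eq_0_iff)
  qed
qed

text \<open>All drift is eaten almost surely, yet by transience a second visit to \<open>0\<close>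
  fails with positive probability, so cookies from index \<open>1\<close> on carry no drift. The
  first cookie then has mean drift \<open>1\<close>, the maximum, hence strength \<open>1\<close>
  almost surely.\<close>

lemma critical_transient:
  assumes "AE \<rho> in Q. inf_visits 0 \<rho> 0 = 0" "(\<integral>\<^sup>+ \<rho>. cookie_sum \<rho> \<partial>Q) \<le> 1"
  shows "AE \<rho> in Q. \<rho> 0 0 = 1 \<and> (\<forall>i\<ge>1. \<rho> 0 i = 1/2)"
proof -
  interpret prob_space Q by (rule prob_Q)
  have drift: "drift {} = 1" using one_le_drift[OF assms(1)] drift_le_1 by simp
  then have sum: "(\<integral>\<^sup>+ \<rho>. cookie_sum \<rho> \<partial>Q) = 1" using drift_le_cookie_sum assms(2) by simp
  have "AE \<rho> in Q. \<forall>i. (2 * \<rho> 0 i - 1) * (1 - visits_lim {} 0 (Suc i) \<rho> 0) = 0"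
    unfolding AE_all_countable using nn_integral_defect_eq_0[OF drift sum] by blast
  \<comment> \<open>Two shifts, because \<open>visits_lim_2_less_1\<close> uses the walk on the
    sites from \<open>2\<close> on.\<close>
  moreover have "AE \<rho> in Q. inf_visits 0 ((env_shift ^^ 2) \<rho>) 0 = 0" by (rule AE_shift_pow[OF assms(1)])
  ultimately have half: "AE \<rho> in Q. \<forall>i\<ge>1. \<rho> 0 i = 1/2"
  proof (rule AE_mp[OF AE_conjI], intro AE_I2 impI allI)
    fix \<rho> i assume "\<rho> \<in> space Q" and i: "1 \<le> (i::nat)"
      and *: "(\<forall>i. (2 * \<rho> 0 i - 1) * (1 - visits_lim {} 0 (Suc i) \<rho> 0) = 0) \<and> inf_visits 0 ((env_shift ^^ 2) \<rho>) 0 = 0"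
    then have env: "cookie_env \<rho>" by (simp only: cookie_env_Q)
    have "visits_lim {} 0 2 \<rho> 0 < 1" using * by (intro visits_lim_2_less_1 env) simp
    moreover have "visits_lim {} 0 (Suc i) \<rho> 0 \<le> visits_lim {} 0 2 \<rho> 0"
      using i by (intro visits_lim_antimono env) simp
    ultimately have "1 - visits_lim {} 0 (Suc i) \<rho> 0 \<noteq> 0" by linarith
    with * have "2 * \<rho> 0 i - 1 = 0" by (metis mult_eq_0_iff)
    then show "\<rho> 0 i = 1/2" by simp
  qed
  have meas: "(\<lambda>\<rho>. ennreal (2 * \<rho> 0 0 - 1)) \<in> borel_measurable Q" "(\<lambda>\<rho>. ennreal (2 - 2 * \<rho> 0 0)) \<in> borel_measurable Q"
    unfolding measurable_cong_sets[OF sets_Q refl]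
    by (intro measurable_compose[OF _ measurable_ennreal] borel_measurable_times borel_measurable_diff
        borel_measurable_const measurable_cookie)+
  have first: "(\<integral>\<^sup>+ \<rho>. cookie_sum \<rho> \<partial>Q) = (\<integral>\<^sup>+ \<rho>. ennreal (2 * \<rho> 0 0 - 1) \<partial>Q)"
  proof (rule nn_integral_cong_AE, use half in \<open>rule AE_mp\<close>, intro AE_I2 impI)
    fix \<rho> :: "nat \<Rightarrow> nat \<Rightarrow> real" assume "\<forall>i\<ge>1. \<rho> 0 i = 1/2"
    then show "cookie_sum \<rho> = ennreal (2 * \<rho> 0 0 - 1)"
    proof -
      have "ennreal (2 * \<rho> 0 i - 1) = 0" if "i \<notin> {0}" for i
      proof -
        have "1 \<le> i" using that by simp
        with \<open>\<forall>i\<ge>1. \<rho> 0 i = 1/2\<close> have "\<rho> 0 i = 1/2" by blast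
        then show ?thesis by simp
      qed
      then show ?thesis unfolding cookie_sum_def by (subst suminf_finite[of "{0}"]) simp_all
    qed
  qed
  have "1 + (\<integral>\<^sup>+ \<rho>. ennreal (2 - 2 * \<rho> 0 0) \<partial>Q) = (\<integral>\<^sup>+ \<rho>. ennreal (2 * \<rho> 0 0 - 1) + ennreal (2 - 2 * \<rho> 0 0) \<partial>Q)"
    unfolding nn_integral_add[OF meas] trans[OF first[symmetric] sum] by (rule refl)
  also have "\<dots> = (\<integral>\<^sup>+ \<rho>. 1 \<partial>Q)"
  proof (rule nn_integral_cong)
    fix \<rho> assume "\<rho> \<in> space Q"
    then have "cookie_env \<rho>" by (simp only: cookie_env_Q)
    from cookie_envD[OF this, of 0 0] show "ennreal (2 * \<rho> 0 0 - 1) + ennreal (2 - 2 * \<rho> 0 0) = 1"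
      by (subst ennreal_plus[symmetric]) auto
  qed
  also have "\<dots> = 1 + 0" by (simp add: emeasure_space_1)
  finally have "(\<integral>\<^sup>+ \<rho>. ennreal (2 - 2 * \<rho> 0 0) \<partial>Q) = 0"
    by (subst (asm) ennreal_add_left_cancel) auto
  then have "AE \<rho> in Q. ennreal (2 - 2 * \<rho> 0 0) = 0" by (rule nn_integral_0_iff_AE[OF meas(2), THEN iffD1])
  from this half show ?thesis
  proof (rule AE_mp[OF AE_conjI], intro AE_I2 impI)
    fix \<rho> assume "\<rho> \<in> space Q" and *: "ennreal (2 - 2 * \<rho> 0 0) = 0 \<and> (\<forall>i\<ge>1. \<rho> 0 i = 1/2)"
    then have "cookie_env \<rho>" by (simp only: cookie_env_Q)
    from cookie_envD(3)[OF this, of 0 0] * show "\<rho> 0 0 = 1 \<and> (\<forall>i\<ge>1. \<rho> 0 i = 1/2)"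
      by (simp add: ennreal_eq_0_iff)
  qed
qed

lemma prob_trivial_cookies:
  assumes "AE \<rho> in Q. \<rho> 0 0 = 1 \<and> (\<forall>i\<ge>1. \<rho> 0 i = 1/2)"
  shows "measure P {\<omega> \<in> space P. \<omega> 0 0 = 1 \<and> (\<forall>i\<ge>1. \<omega> 0 i = 1/2)} = 1"
proof -
  interpret prob_space P by (rule prob)
  let ?c = "\<lambda>i::nat. if i = 0 then 1 else 1/2 :: real"
  have meas: "(\<lambda>\<omega>. \<omega> 0 i) \<in> borel_measurable P" for i
    using measurable_compose[OF restrict_measurable measurable_cookie, of 0 i] by (simp only: of_nat_0)
  have "(\<lambda>\<omega>. \<omega> 0 i) -` {?c i} \<inter> space P \<in> sets P" for i
    by (rule measurable_sets[OF meas]) simp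
  then have "(\<Inter>i. (\<lambda>\<omega>. \<omega> 0 i) -` {?c i} \<inter> space P) \<in> sets P"
    by (intro sets.countable_INT) blast+
  also have "(\<Inter>i. (\<lambda>\<omega>. \<omega> 0 i) -` {?c i} \<inter> space P) = {\<omega> \<in> space P. \<omega> 0 0 = 1 \<and> (\<forall>i\<ge>1. \<omega> 0 i = 1/2)}"
  proof -
    have "(\<forall>i. \<omega> 0 i = ?c i) \<longleftrightarrow> \<omega> 0 0 = 1 \<and> (\<forall>i\<ge>1. \<omega> 0 i = 1/2)" for \<omega> :: env
      by (metis One_nat_def Suc_le_eq bot_nat_0.not_eq_extremum)
    then show ?thesis by blast
  qed
  finally have "{\<omega> \<in> space P. \<omega> 0 0 = 1 \<and> (\<forall>i\<ge>1. \<omega> 0 i = 1/2)} \<in> sets P" .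
  then show ?thesis
    using prob_Collect_eq_1 AE_restrict[OF assms] by (simp only: of_nat_0)
qed

end

theorem mainTheorem12:
  fixes P :: "env measure"
  assumes "prob_space P"
    and "sets P = sets env_space"
    and "stationary_ergodic P"
  shows "(\<forall>x::int. x \<ge> 0 \<longrightarrow>
           annealed_E P 0 (\<lambda>\<omega> X. drift_inf \<omega> x X) = min 1 (\<integral>\<^sup>+ \<omega>. delta \<omega> 0 \<partial>P)) \<and>
         (measure P {\<omega> \<in> space P. \<omega> 0 0 = 1 \<and> (\<forall>i\<ge>1. \<omega> 0 i = 1/2)} < 1 \<longrightarrow>
           (walk_recurrent P \<longleftrightarrow> (\<integral>\<^sup>+ \<omega>. delta \<omega> 0 \<partial>P) \<le> 1))"
proof (intro conjI allI impI)
  interpret stationary_cookies P by (rule stationary_cookies.intro) (fact assms)+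
  show "annealed_E P 0 (\<lambda>\<omega> X. drift_inf \<omega> x X) = min 1 (\<integral>\<^sup>+ \<omega>. delta \<omega> 0 \<partial>P)" if "x \<ge> 0" for x
    using annealed_drift[OF that] drift_eq_min by (simp only: nn_integral_delta)
  assume nontrivial: "measure P {\<omega> \<in> space P. \<omega> 0 0 = 1 \<and> (\<forall>i\<ge>1. \<omega> 0 i = 1/2)} < 1"
  show "walk_recurrent P \<longleftrightarrow> (\<integral>\<^sup>+ \<omega>. delta \<omega> 0 \<partial>P) \<le> 1"
    unfolding nn_integral_delta
  proof
    assume "walk_recurrent P"
    from drift_eq_cookie_sum[OF walk_recurrentD[OF this]] drift_le_1
    show "(\<integral>\<^sup>+ \<rho>. cookie_sum \<rho> \<partial>Q) \<le> 1" by simp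
  next
    assume le: "(\<integral>\<^sup>+ \<rho>. cookie_sum \<rho> \<partial>Q) \<le> 1"
    \<comment> \<open>By \<open>critical_transient\<close>, transience would make the cookies at
      \<open>0\<close> trivial almost surely, against \<open>nontrivial\<close>.\<close>
    have "\<not> (AE \<rho> in Q. inf_visits 0 \<rho> 0 = 0)"
      using prob_trivial_cookies[OF critical_transient[OF _ le]] nontrivial by auto
    with zero_one have "AE \<rho> in Q. inf_visits 0 \<rho> 0 = 1" by blast
    from walk_recurrentI[OF this le] show "walk_recurrent P" .
  qed
qed

end
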